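(* Let $H=(V,E)$ be a finite directed graph with link capacities $c_{uv}>0$, $(u,v)\in E$, and node arrival rates $\lambda_u\ge 0$, $u\in V$. Under the Random-Useful discipline, any such network $H$ is stable if and only if $$\sum_{u\in S}\lambda_u<\sum_{(u,v)\in E:\ u\in S,\ v\notin S}c_{uv}\qquad\text{for all nonempty strict subsets } S\subset V .$$ (Thus, Random-Useful has the maximum stability region.)
   Context: Network model. At each node $u\in V$ new packets arrive exogenously (are created) according to a Poisson process of rate $\lambda_u\ge0$; $u$ is the source of these packets. For each link $(u,v)\in E$ there is a Poisson process of rate $c_{uv}>0$ of communication epochs; at each such epoch node $u$ can instantly transmit (a copy of) one packet to node $v$. All these Poisson processes are mutually independent. Each packet is to be disseminated to all nodes; a packet leaves the network when it is available at all nodes of $V$. A packet is useful on link $(u,v)$ at a given time if it is available at $u$ but not yet available at $v$ (its source need not be $u$). Random-Useful discipline: at each communication epoch of link $(u,v)$, a packet chosen uniformly at random among the packets currently useful on $(u,v)$ is transmitted; if there is none, no transmission occurs. State and stability. The $k$ packets present at time $t$ are labelled $1,\dots,k$ in the order of exogenous arrival (the oldest is labelled 1); a newly arriving packet is labelled $k+1$, and when packet $j$ departs, the labels of packets $j+1,\dots,k$ are decremented by 1. For $(u,v)\in E$, $x_{uv}(t)$ is the subset of (labelled) packets with source $u$ that at time $t$ are not yet available at node $v$. The system evolution is described by $X(t)=(x_{uv}(t))_{(u,v)\in E}$, taken to be an irreducible continuous-time Markov chain with countable state space. The network is stable if $X(\cdot)$ is positive recurrent (equivalently, a stationary distribution exists).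 For given $H$ and capacities $\{c_{uv}\}$, the stability region of a discipline is the set of arrival rate vectors $\{\lambda_u\}$ for which the system is stable; "maximum stability region" refers to the fact that the displayed cut condition is necessary for stability under any discipline.
   Formalization: Added assumption: every nonempty strict subset S of V with no arrivals (all λ_u=0 on S) has an outgoing link; otherwise the inequality reads 0<0 though the network may be stable (V={s,a}, E={(s,a)}, λ_s=1, c=2, λ_a=0). *)

theory Defs
  imports "HOL-Probability.Probability"
begin

section \<open>Continuous-time Markov chains given by their transition rates\<close>

text \<open>
  A chain is given by a function \<open>q\<close>, where \<open>q x y\<close> is the rate of jumps from \<open>x\<close> to \<open>y\<close>
  for \<open>x \<noteq> y\<close>; the diagonal values \<open>q x x\<close> are ignored. The chain is described by the usual
  jump chain / holding time construction: the path consists of the visited states \<open>y 0, y 1, \<dots>\<close>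
  (a discrete-time Markov chain) and of independent exponential variables \<open>w n\<close> of mean 1, the
  holding time in \<open>y n\<close> being \<open>w n\<close> divided by the exit rate of \<open>y n\<close>.
\<close>

definition exit_rate :: "('s \<Rightarrow> 's \<Rightarrow> real) \<Rightarrow> 's \<Rightarrow> real" where
  "exit_rate q x = (\<Sum>\<^sub>\<infinity>y\<in>UNIV - {x}. q x y)"

definition jump_pmf :: "('s \<Rightarrow> 's \<Rightarrow> real) \<Rightarrow> 's \<Rightarrow> 's pmf" where
  "jump_pmf q x =
     (if exit_rate q x = 0 then return_pmf x
      else embed_pmf (\<lambda>y. if y = x then 0 else q x y / exit_rate q x))"

text \<open>Conditional law of the \<open>n\<close>-th visited state given the earlier ones.\<close>

definition jump_kernel :: "('s \<Rightarrow> 's \<Rightarrow> real) \<Rightarrow> 's \<Rightarrow> nat \<Rightarrow> (nat \<Rightarrow> 's) \<Rightarrow> 's measure" where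
  "jump_kernel q x n y =
     (if n = 0 then measure_pmf (return_pmf x) else measure_pmf (jump_pmf q (y (n - 1))))"

definition jump_chain :: "('s \<Rightarrow> 's \<Rightarrow> real) \<Rightarrow> 's \<Rightarrow> (nat \<Rightarrow> 's) measure" where
  "jump_chain q x =
     projective_family.lim UNIV
       (Ionescu_Tulcea.CI (jump_kernel q x) (\<lambda>_. count_space UNIV)) (\<lambda>_. count_space UNIV)"

definition path_measure ::
    "('s \<Rightarrow> 's \<Rightarrow> real) \<Rightarrow> 's \<Rightarrow> ((nat \<Rightarrow> 's) \<times> (nat \<Rightarrow> real)) measure" where
  "path_measure q x =
     jump_chain q x \<Otimes>\<^sub>M (\<Pi>\<^sub>M n\<in>UNIV. density lborel (exponential_density 1))"

text \<open>
  Time of the \<open>n\<close>-th jump. Division in \<^typ>\<open>ennreal\<close> makes the holding time in an absorbing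
  state (exit rate 0) infinite.
\<close>

definition jump_time ::
    "('s \<Rightarrow> 's \<Rightarrow> real) \<Rightarrow> nat \<Rightarrow> (nat \<Rightarrow> 's) \<times> (nat \<Rightarrow> real) \<Rightarrow> ennreal" where
  "jump_time q n = (\<lambda>(y, w). \<Sum>m<n. ennreal (w m) / ennreal (exit_rate q (y m)))"

text \<open>
  First time, from the first jump on, at which the chain is in \<open>x\<close>. The path is constant between
  jumps, so only jump times matter; the infimum is infinite if \<open>x\<close> is never revisited.
\<close>

definition return_time ::
    "('s \<Rightarrow> 's \<Rightarrow> real) \<Rightarrow> 's \<Rightarrow> (nat \<Rightarrow> 's) \<times> (nat \<Rightarrow> real) \<Rightarrow> ennreal" where
  "return_time q x \<omega> = (INF n\<in>{n. 1 \<le> n \<and> fst \<omega> n = x}. jump_time q n \<omega>)"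

definition positive_recurrent :: "('s \<Rightarrow> 's \<Rightarrow> real) \<Rightarrow> 's \<Rightarrow> bool" where
  "positive_recurrent q x \<longleftrightarrow>
     exit_rate q x = 0 \<or> (\<integral>\<^sup>+\<omega>. return_time q x \<omega> \<partial>path_measure q x) < \<infinity>"

text \<open>State space of the chain started in \<open>x\<close>.\<close>

definition reachable :: "('s \<Rightarrow> 's \<Rightarrow> real) \<Rightarrow> 's \<Rightarrow> 's set" where
  "reachable q x = {y. (\<lambda>a b. 0 < q a b)\<^sup>*\<^sup>* x y}"

lemma Ionescu_Tulcea_jump_kernel:
  fixes q :: "'s \<Rightarrow> 's \<Rightarrow> real"
  shows "Ionescu_Tulcea (jump_kernel q x) (\<lambda>_. count_space UNIV)"
proof (rule Ionescu_Tulcea.intro)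
  fix n :: nat
  let ?S = "subprob_algebra (count_space UNIV)"
  let ?P = "PiM {0..<n} (\<lambda>_. count_space UNIV)"
  have pmf: "measure_pmf p \<in> space ?S" for p :: "'s pmf"
    by (rule measure_pmf_in_subprob_algebra)
  show "jump_kernel q x n \<in> ?P \<rightarrow>\<^sub>M ?S"
  proof (cases "n = 0")
    case True
    then have "jump_kernel q x n = (\<lambda>_. measure_pmf (return_pmf x))"
      by (simp add: jump_kernel_def fun_eq_iff)
    then show ?thesis
      using pmf by (simp only: measurable_const)
  next
    case False
    then have kernel: "jump_kernel q x n = (\<lambda>y. measure_pmf (jump_pmf q (y (n - 1))))"
      by (simp add: jump_kernel_def fun_eq_iff)
    have proj: "(\<lambda>y. y (n - 1)) \<in> ?P \<rightarrow>\<^sub>M count_space UNIV"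
      using False by (intro measurable_component_singleton) auto
    have jump: "(\<lambda>s. measure_pmf (jump_pmf q s)) \<in> count_space UNIV \<rightarrow>\<^sub>M ?S"
      unfolding measurable_count_space_eq1 using pmf by (rule Pi_I)
    show ?thesis
      unfolding kernel by (rule measurable_compose[OF proj jump])
  qed
next
  fix n :: nat and y :: "nat \<Rightarrow> 's"
  show "prob_space (jump_kernel q x n y)"
    unfolding jump_kernel_def by (cases "n = 0") (simp_all only: if_True if_False prob_space_measure_pmf simp_thms)
qed

lemma pmf_jump_pmf:
  assumes nonneg: "\<And>y. 0 \<le> q x y" and ne: "exit_rate q x \<noteq> 0"
  shows "pmf (jump_pmf q x) y = (if y = x then 0 else q x y / exit_rate q x)"
proof -
  let ?g = "\<lambda>y. q x y / exit_rate q x"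
  let ?f = "\<lambda>y. if y = x then 0 else ?g y"
  have summable: "q x summable_on (UNIV - {x})"
    using ne infsum_not_exists unfolding exit_rate_def by blast
  have "0 \<le> exit_rate q x"
    unfolding exit_rate_def by (intro infsum_nonneg nonneg)
  then have f_nonneg: "0 \<le> ?f z" for z
    using nonneg by simp
  have "(q x has_sum exit_rate q x) (UNIV - {x})"
    using summable unfolding exit_rate_def by (rule has_sum_infsum)
  then have "(?g has_sum 1) (UNIV - {x})"
    using has_sum_cmult_left[of "q x" "UNIV - {x}" "exit_rate q x" "1 / exit_rate q x"] ne by simp
  moreover have "(?f has_sum 1) UNIV \<longleftrightarrow> (?g has_sum 1) (UNIV - {x})"
    by (rule has_sum_cong_neutral) auto
  ultimately have sum: "(?f has_sum 1) UNIV"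
    by blast
  then have "(\<lambda>z. norm (?f z)) summable_on UNIV"
    using f_nonneg by (simp only: real_norm_def abs_of_nonneg) (rule has_sum_imp_summable)
  then have abs: "Infinite_Set_Sum.abs_summable_on ?f UNIV"
    by (rule abs_summable_equivalent[THEN iffD1])
  have "(\<integral>\<^sup>+z. ennreal (?f z) \<partial>count_space UNIV) = ennreal (infsetsum ?f UNIV)"
    using abs f_nonneg by (intro nn_integral_conv_infsetsum) auto
  also have "\<dots> = 1"
    using infsumI[OF sum] infsetsum_infsum[OF abs] by simp
  finally show ?thesis
    using ne f_nonneg unfolding jump_pmf_def by (simp add: pmf_embed_pmf)
qed

section \<open>The network\<close>

text \<open>
  In a configuration \<open>x\<close>, \<open>x u v\<close> is the set of labels of the packets with source \<open>u\<close> that are not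
  yet available at \<open>v\<close>. It is recorded for all pairs of nodes and not just for the links: otherwise
  the configuration would not determine where a packet is available.
\<close>

type_synonym 'v config = "'v \<Rightarrow> 'v \<Rightarrow> nat set"

definition empty_config :: "'v config" where
  "empty_config = (\<lambda>_ _. {})"

text \<open>A packet is present iff some node still misses it.\<close>

definition packets :: "'v config \<Rightarrow> nat set" where
  "packets x = (\<Union>u v. x u v)"

definition available :: "'v config \<Rightarrow> 'v \<Rightarrow> nat set" where
  "available x v = packets x - (\<Union>u. x u v)"

definition useful :: "'v config \<Rightarrow> 'v \<times> 'v \<Rightarrow> nat set" where
  "useful x = (\<lambda>(u, v). available x u - available x v)"

text \<open>
  The new packet is missing at all nodes but its source; if \<open>V = {u}\<close>, it leaves at once and the
  configuration does not change.
\<close>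

definition arrive :: "'v set \<Rightarrow> 'v config \<Rightarrow> 'v \<Rightarrow> 'v config" where
  "arrive V x u =
     (\<lambda>a b. if a = u \<and> b \<in> V - {u} then insert (card (packets x) + 1) (x a b) else x a b)"

definition depart :: "nat \<Rightarrow> 'v config \<Rightarrow> 'v config" where
  "depart j x = (\<lambda>a b. (\<lambda>i. if i > j then i - 1 else i) ` x a b)"

definition transmit :: "'v config \<Rightarrow> 'v \<Rightarrow> nat \<Rightarrow> 'v config" where
  "transmit x v j =
     (let x' = (\<lambda>a b. if b = v then x a b - {j} else x a b)
      in if j \<in> packets x' then x' else depart j x')"

text \<open>
  A discipline gives, for the current configuration and a link with a communication epoch, the law
  of the packet to be transmitted (\<^const>\<open>None\<close>: no transmission). Only packets available at the
  tail of the link can be transmitted.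
\<close>

type_synonym 'v discipline = "'v config \<Rightarrow> 'v \<times> 'v \<Rightarrow> nat option pmf"

definition admissible :: "('v \<times> 'v) set \<Rightarrow> 'v discipline \<Rightarrow> bool" where
  "admissible E d \<longleftrightarrow> (\<forall>x. \<forall>(u, v)\<in>E. set_pmf (d x (u, v)) \<subseteq> insert None (Some ` available x u))"

definition random_useful :: "'v discipline" where
  "random_useful x e =
     (if useful x e = {} then return_pmf None else map_pmf Some (pmf_of_set (useful x e)))"

text \<open>
  Transition rates resulting from independent Poisson processes of rates \<open>lam u\<close> (arrivals at \<open>u\<close>)
  and \<open>c e\<close> (communication epochs of the link \<open>e\<close>).
\<close>

definition network_rate ::
    "'v set \<Rightarrow> ('v \<times> 'v) set \<Rightarrow> ('v \<times> 'v \<Rightarrow> real) \<Rightarrow> ('v \<Rightarrow> real) \<Rightarrow> 'v discipline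
      \<Rightarrow> 'v config \<Rightarrow> 'v config \<Rightarrow> real" where
  "network_rate V E c lam d x y =
     (\<Sum>u\<in>V. lam u * of_bool (arrive V x u = y)) +
     (\<Sum>(u, v)\<in>E. c (u, v) *
        pmf (map_pmf (\<lambda>r. case r of None \<Rightarrow> x | Some j \<Rightarrow> transmit x v j) (d x (u, v))) y)"

text \<open>
  The state space consists of the configurations reachable from the empty one. If all of them are
  positive recurrent, the chain is irreducible on it; for an irreducible chain, it suffices that
  one of them is.
\<close>

definition stable ::
    "'v set \<Rightarrow> ('v \<times> 'v) set \<Rightarrow> ('v \<times> 'v \<Rightarrow> real) \<Rightarrow> ('v \<Rightarrow> real) \<Rightarrow> 'v discipline \<Rightarrow> bool" where
  "stable V E c lam d \<longleftrightarrow>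
     (\<forall>x\<in>reachable (network_rate V E c lam d) empty_config.
        positive_recurrent (network_rate V E c lam d) x)"

text \<open>
  For a set \<open>S\<close> without arrivals and without outgoing links, the inequality reads \<open>0 < 0\<close>,
  although no packet ever starts in \<open>S\<close> and the chain may well be positive recurrent.
\<close>

definition cut_condition ::
    "'v set \<Rightarrow> ('v \<times> 'v) set \<Rightarrow> ('v \<times> 'v \<Rightarrow> real) \<Rightarrow> ('v \<Rightarrow> real) \<Rightarrow> bool" where
  "cut_condition V E c lam \<longleftrightarrow>
     (\<forall>S. S \<noteq> {} \<and> S \<subset> V \<longrightarrow> (\<Sum>u\<in>S. lam u) < (\<Sum>e\<in>{(u, v)\<in>E. u \<in> S \<and> v \<notin> S}. c e))"

end

(*
  Let M S be the number of packets all of whose holders lie in S. For an arbitrary discipline, M S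
  grows at rate lam S and decreases at rate at most c(S), the capacity of the links leaving S. If
  lam S >= c(S), then M S is a submartingale along the jump chain started in the empty
  configuration; as M S is at most n after n jumps, the n-th jump precedes the first return with
  probability at least a / n, so the expected return time is infinite.

  Conversely, Random-Useful makes the sum over S of exp (\<theta> * \<beta> S * M S) a Lyapunov function,
  for weights \<beta> S that decrease slowly with the cardinality of S. When \<beta> S * M S is maximal,
  almost all packets useful on a link leaving S are confined to S, so that M S has negative drift by
  the cut condition; the sets S for which this fails have a weighted occupancy that is smaller than
  the maximum by a constant factor, and hence contribute negligibly.
*)

theory Submission
  imports Defs
begin

section \<open>Expected return times via the jump chain killed at the starting state\<close>

text \<open>Return times are defined on path space, whereas drift concerns a single jump. The bridge
  is the kernel \<open>taboo q x\<close>, which discards the mass that jumps to \<open>x\<close>: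
  since the holding times are independent of the jump chain and have mean 1 before scaling, the
  expected return time is at least the sum over m of the m-th power of this kernel applied to the
  inverse exit rate, and equal to it when the mean number of jumps is finite. At equality of arrival
  rate and capacity the chain can be null recurrent, so transience is too much to ask for; the
  divergence of the harmonic series covers this borderline as well. For Random-Useful, the
  difficulty is a set \<open>S\<close> whose confined packets are rarely chosen on a link (u, v), in
  the extreme because u holds none of them. Those packets are then confined to S - {u} as well, so
  plain counts need not show any gain. The decreasing weights create one. They decay geometrically
  so that the weight lost in passing from S to V - {v} is small compared with the weight gained in
  passing to S - {u}.\<close>

definition taboo :: "('s \<Rightarrow> 's \<Rightarrow> real) \<Rightarrow> 's \<Rightarrow> ('s \<Rightarrow> ennreal) \<Rightarrow> 's \<Rightarrow> ennreal" where
  "taboo q x f z = (\<integral>\<^sup>+y. indicator (- {x}) y * f y \<partial>jump_pmf q z)"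

text \<open>As a product, the indicator for \<open>Suc m\<close> splits off one factor that depends
  on coordinate \<open>Suc m\<close> alone, which suits an induction along the kernels. The range
  starts at 1 because coordinate 0 is \<open>x\<close> itself.\<close>

definition unreturned :: "'s \<Rightarrow> nat \<Rightarrow> (nat \<Rightarrow> 's) \<Rightarrow> ennreal" where
  "unreturned x m y = (\<Prod>k\<in>{1..m}. indicator (- {x}) (y k))"

lemma coordinate_measurable:
  assumes "k \<in> I"
  shows "(\<lambda>y. g (y k)) \<in> borel_measurable (PiM I (\<lambda>_. count_space UNIV))"
  by (rule measurable_compose[OF measurable_component_singleton[OF assms]]) simp

lemma unreturned_measurable:
  assumes "{1..m} \<subseteq> I"
  shows "unreturned x m \<in> borel_measurable (PiM I (\<lambda>_. count_space UNIV))"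
proof -
  have "(\<lambda>y. \<Prod>k\<in>{1..m}. indicator (- {x}) (y k) :: ennreal) \<in> borel_measurable (PiM I (\<lambda>_. count_space UNIV))"
    for x :: 's
    using assms by (intro borel_measurable_prod_ennreal coordinate_measurable) auto
  then show ?thesis
    by (simp add: unreturned_def[abs_def])
qed

text \<open>Integrating out the last coordinate turns \<open>f\<close> into
  \<open>taboo q x f\<close>, evaluated at the previous state; so \<open>f\<close> must vary in the
  induction. The law of coordinates 0 to m takes \<open>Suc m\<close> kernels, the first of which
  only places the chain at \<open>x\<close>.\<close>

lemma nn_integral_unreturned_C:
  fixes x :: 's
  shows "(\<integral>\<^sup>+y. unreturned x m y * f (y m)
      \<partial>Ionescu_Tulcea.C (jump_kernel q x) (\<lambda>_. count_space UNIV) 0 (Suc m) (\<lambda>_. undefined))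
    = (taboo q x ^^ m) f x"
proof (induction m arbitrary: f)
  interpret IT: Ionescu_Tulcea "jump_kernel q x" "\<lambda>_. count_space UNIV"
    by (rule Ionescu_Tulcea_jump_kernel)
  let ?M = "\<lambda>n. PiM {0..<n::nat} (\<lambda>_. count_space UNIV :: 's measure)"
  let ?u = "\<lambda>_. undefined"
  have C_Suc: "(\<integral>\<^sup>+y. g y \<partial>IT.C 0 (Suc n) ?u)
      = (\<integral>\<^sup>+y. \<integral>\<^sup>+z. g (y(n := z)) \<partial>jump_kernel q x n y \<partial>IT.C 0 n ?u)"
    if g: "g \<in> borel_measurable (?M (Suc n))" for n and g :: "_ \<Rightarrow> ennreal"
  proof -
    have sp: "?u \<in> space (?M 0)" by simp
    have "IT.eP n \<in> IT.C 0 n ?u \<rightarrow>\<^sub>M subprob_algebra (?M (Suc n))"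
      using IT.measurable_eP[of n] by (simp add: measurable_cong_sets[OF IT.sets_C[OF sp] refl])
    then have "(\<integral>\<^sup>+y. g y \<partial>IT.C 0 (Suc n) ?u) = (\<integral>\<^sup>+y. \<integral>\<^sup>+z. g z \<partial>IT.eP n y \<partial>IT.C 0 n ?u)"
      using g by (simp add: nn_integral_bind[where B="?M (Suc n)"])
    also have "\<dots> = (\<integral>\<^sup>+y. \<integral>\<^sup>+z. g (y(n := z)) \<partial>jump_kernel q x n y \<partial>IT.C 0 n ?u)"
      by (intro nn_integral_cong) (use g in \<open>auto simp: IT.space_C[OF sp] IT.nn_integral_eP\<close>)
    finally show ?thesis .
  qed
  have meas: "(\<lambda>y. unreturned x n y * h (y n)) \<in> borel_measurable (?M (Suc n))" for n and h :: "'s \<Rightarrow> ennreal"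
    by (intro borel_measurable_times_ennreal unreturned_measurable coordinate_measurable) auto
  {
    case 0
    have "emeasure (return (?M 0) ?u) (space (?M 0)) = 1"
      by (simp add: emeasure_return)
    moreover have "jump_kernel q x 0 y = measure_pmf (return_pmf x)" for y
      by (simp add: jump_kernel_def)
    ultimately show ?case
      using C_Suc[OF meas[of 0 f]]
      by (simp add: unreturned_def nn_integral_return del: IT.C.simps(2))
  next
    case (Suc m)
    have "(\<integral>\<^sup>+z. unreturned x (Suc m) (y(Suc m := z)) * f ((y(Suc m := z)) (Suc m))
        \<partial>jump_kernel q x (Suc m) y) = unreturned x m y * taboo q x f (y m)" for y
    proof -
      have "unreturned x (Suc m) (y(Suc m := z)) = unreturned x m y * indicator (- {x}) z" for z
        by (auto simp: unreturned_def atLeastAtMostSuc_conv mult.commute intro!: arg_cong2[where f=times] prod.cong)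
      then show ?thesis
        by (simp add: jump_kernel_def taboo_def mult.assoc nn_integral_cmult)
    qed
    then have "(\<integral>\<^sup>+y. unreturned x (Suc m) y * f (y (Suc m)) \<partial>IT.C 0 (Suc (Suc m)) ?u)
      = (\<integral>\<^sup>+y. unreturned x m y * taboo q x f (y m) \<partial>IT.C 0 (Suc m) ?u)"
      by (simp only: C_Suc[OF meas])
    also have "\<dots> = (taboo q x ^^ m) (taboo q x f) x"
      by (rule Suc.IH)
    finally show ?case
      by (simp only: funpow_Suc_right o_apply)
  }
qed

lemma sets_jump_chain: "sets (jump_chain q x) = sets (PiM UNIV (\<lambda>_. count_space UNIV))"
proof -
  interpret IT: Ionescu_Tulcea "jump_kernel q x" "\<lambda>_. count_space UNIV"
    by (rule Ionescu_Tulcea_jump_kernel)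
  show ?thesis
    unfolding jump_chain_def by simp
qed

text \<open>The integrand looks at coordinates 0 to m only, so the projective limit may be replaced
  by its marginal on them.\<close>

lemma nn_integral_unreturned_jump_chain:
  fixes x :: 's
  shows "(\<integral>\<^sup>+y. unreturned x m y * f (y m) \<partial>jump_chain q x) = (taboo q x ^^ m) f x"
proof -
  interpret IT: Ionescu_Tulcea "jump_kernel q x" "\<lambda>_. count_space UNIV"
    by (rule Ionescu_Tulcea_jump_kernel)
  let ?J = "{0..<Suc m}" and ?M = "\<lambda>J. PiM J (\<lambda>_. count_space UNIV :: 's measure)"
  let ?g = "\<lambda>y. unreturned x m y * f (y m)"
  have up: "IT.up_to ?J = Suc m"
    unfolding IT.up_to_def by (intro Least_equality) (auto simp: not_less_eq_eq[symmetric])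
  have C: "IT.CI ?J = IT.C 0 (Suc m) (\<lambda>_. undefined)"
    unfolding IT.CI_def up using IT.distr_C[of "Suc m" "Suc m" "\<lambda>_. undefined" 0] by (simp del: IT.C.simps)
  have meas: "?g \<in> borel_measurable (?M ?J)"
    by (intro borel_measurable_times_ennreal unreturned_measurable coordinate_measurable) auto
  have restr_meas: "(\<lambda>y. restrict y ?J) \<in> jump_chain q x \<rightarrow>\<^sub>M ?M ?J"
    unfolding measurable_cong_sets[OF sets_jump_chain refl] by (rule measurable_restrict_subset) simp
  have restr: "?g (restrict y ?J) = ?g y" for y
    by (auto simp: unreturned_def)
  have "(\<integral>\<^sup>+y. ?g y \<partial>jump_chain q x) = (\<integral>\<^sup>+y. ?g (restrict y ?J) \<partial>jump_chain q x)"
    by (simp only: restr)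
  also have "\<dots> = (\<integral>\<^sup>+y. ?g y \<partial>distr (jump_chain q x) (?M ?J) (\<lambda>y. restrict y ?J))"
    using meas restr_meas by (intro nn_integral_distr[symmetric]) (simp_all only: measurable_distr_eq1)
  also have "\<dots> = (\<integral>\<^sup>+y. ?g y \<partial>IT.C 0 (Suc m) (\<lambda>_. undefined))"
    unfolding jump_chain_def by (simp only: IT.distr_lim[of ?J] C finite_atLeastLessThan)
  also have "\<dots> = (taboo q x ^^ m) f x"
    by (rule nn_integral_unreturned_C)
  finally show ?thesis .
qed

section \<open>Holding times and the expected return time\<close>

lemma prob_space_exponential_1: "prob_space (density lborel (exponential_density 1))"
  by (rule prob_space_exponential_density) simp

text \<open>The exponential density is the Erlang density of shape 0, so this is its first moment.
  \<open>ennreal\<close> truncates negative arguments, where the density vanishes.\<close>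

lemma nn_integral_exponential_1: "(\<integral>\<^sup>+w. ennreal w \<partial>density lborel (exponential_density 1)) = 1"
proof -
  have "(\<integral>\<^sup>+w. ennreal w \<partial>density lborel (exponential_density 1))
      = (\<integral>\<^sup>+w. ennreal (exponential_density 1 w * w ^ 1) \<partial>lborel)"
    by (subst nn_integral_density) (auto intro!: nn_integral_cong simp: ennreal_mult' exponential_density_def)
  also have "\<dots> = 1"
    by (subst nn_integral_erlang_ith_moment) auto
  finally show ?thesis .
qed

abbreviation holding_measure :: "(nat \<Rightarrow> real) measure" where
  "holding_measure \<equiv> \<Pi>\<^sub>M n\<in>UNIV. density lborel (exponential_density 1)"

lemma holding_time_measurable: "(\<lambda>w. ennreal (w m)) \<in> borel_measurable holding_measure"
proof -
  have "sets holding_measure = sets (PiM UNIV (\<lambda>_. borel))"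
    by (intro sets_PiM_cong) auto
  then show ?thesis
    by (subst measurable_cong_sets[OF _ refl]) measurable
qed

lemma unreturned_times_measurable:
  "(\<lambda>y. unreturned x m y * g (y m)) \<in> borel_measurable (jump_chain q x)"
  unfolding measurable_cong_sets[OF sets_jump_chain refl]
  by (intro borel_measurable_times_ennreal unreturned_measurable coordinate_measurable) auto

lemma nn_integral_path_fst:
  assumes "g \<in> borel_measurable (jump_chain q x)"
  shows "(\<integral>\<^sup>+\<omega>. g (fst \<omega>) \<partial>path_measure q x) = (\<integral>\<^sup>+y. g y \<partial>jump_chain q x)"
proof -
  interpret W: prob_space holding_measure
    by (intro prob_space_PiM prob_space_exponential_1)
  have "(\<lambda>\<omega>. g (fst \<omega>)) \<in> borel_measurable (jump_chain q x \<Otimes>\<^sub>M holding_measure)"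
    by (rule measurable_compose[OF measurable_fst assms])
  from W.nn_integral_fst[OF this] show ?thesis
    by (simp add: path_measure_def W.emeasure_space_1)
qed

lemma path_step_measurable:
  "(\<lambda>\<omega>. unreturned x m (fst \<omega>) * (ennreal (snd \<omega> m) / ennreal (exit_rate q (fst \<omega> m))))
    \<in> borel_measurable (path_measure q x)"
proof -
  have "(\<lambda>\<omega>. unreturned x m (fst \<omega>) * inverse (ennreal (exit_rate q (fst \<omega> m))))
      \<in> borel_measurable (path_measure q x)"
    unfolding path_measure_def by (rule measurable_compose[OF measurable_fst unreturned_times_measurable])
  moreover have "(\<lambda>\<omega>. ennreal (snd \<omega> m)) \<in> borel_measurable (path_measure q x)"
    unfolding path_measure_def by (rule measurable_compose[OF measurable_snd holding_time_measurable])
  ultimately have "(\<lambda>\<omega>. unreturned x m (fst \<omega>) * inverse (ennreal (exit_rate q (fst \<omega> m))) * ennreal (snd \<omega> m))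
      \<in> borel_measurable (path_measure q x)"
    by (rule borel_measurable_times_ennreal)
  then show ?thesis
    by (simp add: divide_ennreal_def mult.assoc mult.commute[of "ennreal (snd _ _)"])
qed

text \<open>The m-th holding variable is integrated out first: it is independent of the jump chain
  and has mean 1. At an absorbing state both sides see the infinite value of
  \<open>inverse 0\<close>.\<close>

lemma nn_integral_path_step:
  "(\<integral>\<^sup>+\<omega>. unreturned x m (fst \<omega>) * (ennreal (snd \<omega> m) / ennreal (exit_rate q (fst \<omega> m))) \<partial>path_measure q x)
    = (taboo q x ^^ m) (\<lambda>z. inverse (ennreal (exit_rate q z))) x"
proof -
  interpret W: prob_space holding_measure
    by (intro prob_space_PiM prob_space_exponential_1)
  have "(\<integral>\<^sup>+w. ennreal (w m) \<partial>holding_measure)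
      = (\<integral>\<^sup>+w. ennreal w \<partial>distr holding_measure (density lborel (exponential_density 1)) (\<lambda>w. w m))"
    by (rule nn_integral_distr[symmetric]) (auto intro: measurable_component_singleton)
  then have int_w: "(\<integral>\<^sup>+w. ennreal (w m) \<partial>holding_measure) = 1"
    by (subst (asm) distr_PiM_component) (auto simp: prob_space_exponential_1 nn_integral_exponential_1)
  let ?F = "\<lambda>\<omega>. unreturned x m (fst \<omega>) * (ennreal (snd \<omega> m) / ennreal (exit_rate q (fst \<omega> m)))"
  have "(\<integral>\<^sup>+\<omega>. ?F \<omega> \<partial>path_measure q x) = (\<integral>\<^sup>+y. \<integral>\<^sup>+w. ?F (y, w) \<partial>holding_measure \<partial>jump_chain q x)"
    unfolding path_measure_def
    by (rule W.nn_integral_fst[symmetric]) (rule path_step_measurable[unfolded path_measure_def])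
  also have "\<dots> = (\<integral>\<^sup>+y. unreturned x m y * inverse (ennreal (exit_rate q (y m))) \<partial>jump_chain q x)"
    using holding_time_measurable[of m]
    by (simp add: divide_ennreal_def nn_integral_cmult nn_integral_multc int_w)
  also have "\<dots> = (taboo q x ^^ m) (\<lambda>z. inverse (ennreal (exit_rate q z))) x"
    by (rule nn_integral_unreturned_jump_chain)
  finally show ?thesis .
qed

lemma unreturned_eq: "unreturned x m y = (if \<exists>k\<in>{1..m}. y k = x then 0 else 1)"
  by (auto simp: unreturned_def indicator_def)

text \<open>For every \<open>n\<close> at which the path is back in \<open>x\<close>, the indicators
  vanish from step \<open>n\<close> on, so the series is part of the n-th jump time. On a path that
  never returns the infimum is infinite.\<close>

lemma return_time_ge:
  "(\<Sum>m. unreturned x m (fst \<omega>) * (ennreal (snd \<omega> m) / ennreal (exit_rate q (fst \<omega> m)))) \<le> return_time q x \<omega>"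
  unfolding return_time_def
proof (rule INF_greatest)
  fix n assume n: "n \<in> {n. 1 \<le> n \<and> fst \<omega> n = x}"
  let ?t = "\<lambda>m. ennreal (snd \<omega> m) / ennreal (exit_rate q (fst \<omega> m))"
  have "(\<Sum>m. unreturned x m (fst \<omega>) * ?t m) = (\<Sum>m<n. unreturned x m (fst \<omega>) * ?t m)"
    by (rule suminf_finite) (use n in \<open>auto simp: unreturned_eq\<close>)
  also have "\<dots> \<le> (\<Sum>m<n. ?t m)"
    by (intro sum_mono) (auto simp: unreturned_eq)
  also have "\<dots> = jump_time q n \<omega>"
    by (simp add: jump_time_def case_prod_beta)
  finally show "(\<Sum>m. unreturned x m (fst \<omega>) * ?t m) \<le> jump_time q n \<omega>" .
qed

text \<open>At the first return the series agrees with the jump time. The assumption enforces a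
  return: on a path without one the return time is infinite, although the holding times may have a
  finite sum.\<close>

lemma return_time_le:
  assumes "(\<Sum>m. unreturned x m (fst \<omega>)) \<noteq> \<infinity>"
  shows "return_time q x \<omega> \<le> (\<Sum>m. unreturned x m (fst \<omega>) * (ennreal (snd \<omega> m) / ennreal (exit_rate q (fst \<omega> m))))"
proof -
  let ?t = "\<lambda>m. ennreal (snd \<omega> m) / ennreal (exit_rate q (fst \<omega> m))"
  have "\<exists>n\<ge>1. fst \<omega> n = x"
  proof (rule ccontr)
    assume "\<not> ?thesis"
    then have "unreturned x m (fst \<omega>) = ennreal 1" for m
      by (auto simp: unreturned_eq)
    then have "summable (\<lambda>m::nat. 1 :: real)"
      using assms by (intro summable_suminf_not_top) auto
    then show False
      using summable_const_iff[of "1::real"] by simp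
  qed
  then obtain n where "1 \<le> n \<and> fst \<omega> n = x" "\<forall>k<n. \<not> (1 \<le> k \<and> fst \<omega> k = x)"
    using exists_least_iff[of "\<lambda>n. 1 \<le> n \<and> fst \<omega> n = x"] by blast
  then have n: "1 \<le> n" "fst \<omega> n = x" "\<And>k. 1 \<le> k \<Longrightarrow> k < n \<Longrightarrow> fst \<omega> k \<noteq> x"
    by auto
  have "return_time q x \<omega> \<le> jump_time q n \<omega>"
    unfolding return_time_def using n by (intro INF_lower) auto
  also have "\<dots> = (\<Sum>m<n. ?t m)"
    by (simp add: jump_time_def case_prod_beta)
  also have "\<dots> = (\<Sum>m<n. unreturned x m (fst \<omega>) * ?t m)"
    using n by (intro sum.cong) (auto simp: unreturned_eq)
  also have "\<dots> \<le> (\<Sum>m. unreturned x m (fst \<omega>) * ?t m)"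
    by (intro sum_le_suminf) auto
  finally show ?thesis .
qed

lemma expected_return_time_ge:
  "(\<Sum>m. (taboo q x ^^ m) (\<lambda>z. inverse (ennreal (exit_rate q z))) x) \<le> (\<integral>\<^sup>+\<omega>. return_time q x \<omega> \<partial>path_measure q x)"
  by (subst nn_integral_path_step[symmetric], subst nn_integral_suminf[symmetric, OF path_step_measurable])
    (intro nn_integral_mono return_time_ge)

text \<open>A finite mean number of jumps before the return makes this number finite almost surely,
  which is what the pathwise bound \<open>return_time_le\<close> asks for.\<close>

lemma expected_return_time_le:
  assumes "(\<Sum>m. (taboo q x ^^ m) (\<lambda>_. 1) x) \<noteq> \<infinity>"
  shows "(\<integral>\<^sup>+\<omega>. return_time q x \<omega> \<partial>path_measure q x)
    \<le> (\<Sum>m. (taboo q x ^^ m) (\<lambda>z. inverse (ennreal (exit_rate q z))) x)"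
proof -
  have meas: "(\<lambda>\<omega>. unreturned x m (fst \<omega>)) \<in> borel_measurable (path_measure q x)" for m
    unfolding path_measure_def
    using measurable_compose[OF measurable_fst unreturned_times_measurable[where g="\<lambda>_. 1"]] by simp
  have "(\<integral>\<^sup>+\<omega>. unreturned x m (fst \<omega>) \<partial>path_measure q x) = (taboo q x ^^ m) (\<lambda>_. 1) x" for m
    using nn_integral_path_fst[OF unreturned_times_measurable[where g="\<lambda>_. 1" and q=q and x=x and m=m]]
      nn_integral_unreturned_jump_chain[where f="\<lambda>_. 1" and q=q and x=x and m=m] by simp
  then have "(\<integral>\<^sup>+\<omega>. (\<Sum>m. unreturned x m (fst \<omega>)) \<partial>path_measure q x) \<noteq> \<infinity>"
    using assms by (simp add: nn_integral_suminf meas)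
  then have "AE \<omega> in path_measure q x. (\<Sum>m. unreturned x m (fst \<omega>)) \<noteq> \<infinity>"
    by (intro nn_integral_PInf_AE borel_measurable_suminf_order meas)
  then have "AE \<omega> in path_measure q x. return_time q x \<omega>
      \<le> (\<Sum>m. unreturned x m (fst \<omega>) * (ennreal (snd \<omega> m) / ennreal (exit_rate q (fst \<omega> m))))"
    by eventually_elim (rule return_time_le)
  then show ?thesis
    by (subst nn_integral_path_step[symmetric], subst nn_integral_suminf[symmetric, OF path_step_measurable])
      (rule nn_integral_mono_AE)
qed

text \<open>Unlike in \<open>exit_rate\<close>, the diagonal is included: \<open>q z z\<close>
  collects the events that leave \<open>z\<close> unchanged. In the network all events together have
  a constant rate \<open>R\<close>, so the drift of \<open>f\<close> is
  \<open>rate_sum q f z\<close> minus \<open>R\<close> times \<open>f z\<close>, as for a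
  uniformized chain.\<close>

definition rate_sum :: "('s \<Rightarrow> 's \<Rightarrow> real) \<Rightarrow> ('s \<Rightarrow> ennreal) \<Rightarrow> 's \<Rightarrow> ennreal" where
  "rate_sum q f z = (\<integral>\<^sup>+y. ennreal (q z y) * f y \<partial>count_space UNIV)"

lemma exit_rate_nonneg: "(\<And>y. 0 \<le> q z y) \<Longrightarrow> 0 \<le> exit_rate q z"
  unfolding exit_rate_def by (rule infsum_nonneg)

lemma set_jump_pmf:
  assumes "\<And>y. 0 \<le> q z y" "y \<in> set_pmf (jump_pmf q z)"
  shows "y = z \<or> 0 < q z y"
proof (cases "exit_rate q z = 0")
  case True
  then show ?thesis using assms by (simp add: jump_pmf_def)
next
  case False
  have "pmf (jump_pmf q z) y \<noteq> 0"
    using assms(2) by (simp add: set_pmf_iff)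
  then show ?thesis
    using pmf_jump_pmf[OF assms(1) False] assms(1)[of y] by (auto split: if_splits simp: less_le)
qed

lemma rate_sum_eq:
  assumes nonneg: "\<And>y. 0 \<le> q z y" and ne: "exit_rate q z \<noteq> 0"
  shows "rate_sum q f z = ennreal (exit_rate q z) * (\<integral>\<^sup>+y. f y \<partial>jump_pmf q z) + ennreal (q z z) * f z"
proof -
  let ?r = "exit_rate q z"
  have r: "0 < ?r"
    using exit_rate_nonneg[of q z] nonneg ne by simp
  have "ennreal ?r * (\<integral>\<^sup>+y. f y \<partial>jump_pmf q z)
      = (\<integral>\<^sup>+y. ennreal ?r * (ennreal (pmf (jump_pmf q z) y) * f y) \<partial>count_space UNIV)"
    by (simp add: nn_integral_measure_pmf nn_integral_cmult)
  also have "\<dots> = (\<integral>\<^sup>+y. ennreal (q z y) * f y * indicator (- {z}) y \<partial>count_space UNIV)"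
    using r by (intro nn_integral_cong)
      (auto simp: pmf_jump_pmf[OF nonneg ne] mult.assoc[symmetric] ennreal_mult'[symmetric] nonneg)
  finally have A: "ennreal ?r * (\<integral>\<^sup>+y. f y \<partial>jump_pmf q z)
    = (\<integral>\<^sup>+y. ennreal (q z y) * f y * indicator (- {z}) y \<partial>count_space UNIV)" .
  have B: "ennreal (q z z) * f z = (\<integral>\<^sup>+y. ennreal (q z y) * f y * indicator {z} y \<partial>count_space UNIV)"
    by (subst nn_integral_indicator_singleton) (auto simp: one_ennreal_def[symmetric])
  show ?thesis
    unfolding A B rate_sum_def
    by (subst nn_integral_add[symmetric]) (auto intro!: nn_integral_cong simp: indicator_def)
qed

section \<open>Calculus of the killed kernel\<close>

lemma taboo_mono:
  assumes "\<And>y. y \<in> set_pmf (jump_pmf q z) \<Longrightarrow> f y \<le> g y"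
  shows "taboo q x f z \<le> taboo q x g z"
  unfolding taboo_def
  by (intro nn_integral_mono_AE) (auto simp: AE_measure_pmf_iff assms intro!: mult_left_mono)

text \<open>The sets depend on the number of jumps. A constant family restricts the comparison to a
  closed set of states; a growing family expresses that a function is at most m after m
  jumps.\<close>

lemma taboo_pow_mono:
  assumes "\<And>m z y. z \<in> X m \<Longrightarrow> y \<in> set_pmf (jump_pmf q z) \<Longrightarrow> y \<in> X (Suc m)"
    and "\<And>y. y \<in> X (n + m) \<Longrightarrow> f y \<le> g y" and "z \<in> X n"
  shows "(taboo q x ^^ m) f z \<le> (taboo q x ^^ m) g z"
  using assms(2,3)
proof (induction m arbitrary: n z)
  case (Suc m)
  have "taboo q x ((taboo q x ^^ m) f) z \<le> taboo q x ((taboo q x ^^ m) g) z"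
    by (rule taboo_mono, rule Suc.IH[of "Suc n"]) (use Suc.prems assms(1) in auto)
  then show ?case by simp
qed auto

lemma taboo_add: "taboo q x (\<lambda>y. f y + g y) z = taboo q x f z + taboo q x g z"
  unfolding taboo_def by (subst nn_integral_add[symmetric]) (auto simp: distrib_left)

lemma taboo_cmult: "taboo q x (\<lambda>y. c * f y) z = c * taboo q x f z"
  unfolding taboo_def by (subst nn_integral_cmult[symmetric]) (auto simp: mult.left_commute)

lemma taboo_sum: "finite I \<Longrightarrow> taboo q x (\<lambda>y. \<Sum>i\<in>I. f i y) z = (\<Sum>i\<in>I. taboo q x (f i) z)"
proof (induction I rule: finite_induct)
  case empty
  then show ?case by (simp add: taboo_def)
qed (simp add: taboo_add)

lemma taboo_pow_add_cmult:
  "(taboo q x ^^ m) (\<lambda>y. f y + c * g y) z = (taboo q x ^^ m) f z + c * (taboo q x ^^ m) g z"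
proof (induction m arbitrary: z)
  case (Suc m)
  then have "(taboo q x ^^ m) (\<lambda>y. f y + c * g y) = (\<lambda>z. (taboo q x ^^ m) f z + c * (taboo q x ^^ m) g z)"
    by auto
  then show ?case by (simp add: taboo_add taboo_cmult)
qed auto

lemma taboo_pow_1_le: "(taboo q x ^^ m) (\<lambda>_. 1) z \<le> 1"
proof (induction m arbitrary: z)
  case (Suc m)
  have "(taboo q x ^^ Suc m) (\<lambda>_. 1) z \<le> taboo q x (\<lambda>_. 1) z"
    using Suc by (auto intro: taboo_mono)
  also have "\<dots> \<le> (\<integral>\<^sup>+y. 1 \<partial>jump_pmf q z)"
    unfolding taboo_def by (intro nn_integral_mono) (auto simp: indicator_def)
  finally show ?case by simp
qed auto

lemma taboo_le: "taboo q x f z \<le> (\<integral>\<^sup>+y. f y \<partial>jump_pmf q z)"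
  unfolding taboo_def by (intro nn_integral_mono) (auto simp: indicator_def)

lemma taboo_pow_1_antimono:
  "m \<le> n \<Longrightarrow> (taboo q x ^^ n) (\<lambda>_. 1) z \<le> (taboo q x ^^ m) (\<lambda>_. 1) z"
proof (induction n rule: dec_induct)
  case (step n)
  have "(taboo q x ^^ Suc n) (\<lambda>_. 1) z \<le> (taboo q x ^^ n) (\<lambda>_. 1) z"
    unfolding funpow_Suc_right o_apply
    by (rule taboo_pow_mono[where X="\<lambda>_. UNIV"]) (use taboo_pow_1_le[of 1] in auto)
  then show ?case using step by order
qed auto

text \<open>
  The exceptional set \<open>F\<close> is absorbed by adding a multiple of the expected number \<open>h\<close> of steps
  before the return or time \<open>N\<close>: it satisfies \<open>h z - taboo q x h z = 1 - s N z\<close>, which is positive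
  on \<open>F\<close> and never negative.
\<close>

lemma taboo_sum_finite:
  fixes L b :: "'s \<Rightarrow> ennreal"
  assumes closed: "\<And>z y. z \<in> X \<Longrightarrow> y \<in> set_pmf (jump_pmf q z) \<Longrightarrow> y \<in> X"
    and x: "x \<in> X" and L: "L x < \<infinity>" and F: "finite F"
    and eps: "0 < (\<epsilon>::real)"
    and drift: "\<And>z. z \<in> X \<Longrightarrow> taboo q x L z + ennreal \<epsilon> \<le> L z + b z"
    and b: "\<And>z. z \<in> X - F \<Longrightarrow> b z = 0" "\<And>z. z \<in> F \<Longrightarrow> b z < \<infinity>"
    and hit: "\<And>z. z \<in> F \<Longrightarrow> \<exists>k. (taboo q x ^^ k) (\<lambda>_. 1) z < 1"
  shows "(\<Sum>m. (taboo q x ^^ m) (\<lambda>_. 1) x) < \<infinity>"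
proof -
  define s where "s k = (taboo q x ^^ k) (\<lambda>_. 1)" for k
  have s_le: "s k z \<le> 1" for k z
    unfolding s_def by (rule taboo_pow_1_le)
  obtain k where k: "\<And>z. z \<in> F \<Longrightarrow> s (k z) z < 1"
    using hit unfolding s_def by metis
  obtain N where N: "\<And>z. z \<in> F \<Longrightarrow> k z \<le> N"
    using finite_nat_set_iff_bounded_le[of "k ` F"] F by auto
  have sN: "s N z < 1" if "z \<in> F" for z
    using taboo_pow_1_antimono[OF N[OF that], of q x z] k[OF that] unfolding s_def by order
  \<comment> \<open>The multiple of \<open>h\<close> to be added. Since the decrease of
    \<open>h\<close> at \<open>z\<close> is \<open>1 - s N z\<close>, each quotient is the amount
    that pays for \<open>b z\<close>, and the sum dominates all of them at once.\<close>
  define c where "c = (\<Sum>z\<in>F. b z / (1 - s N z))"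
  have term_finite: "b z / (1 - s N z) < \<infinity>" if "z \<in> F" for z
    using b(2)[OF that] sN[OF that] ennreal_minus_eq_0[of 1 "s N z"]
    by (auto simp: ennreal_divide_eq_top_iff less_top[symmetric])
  have c: "c < \<infinity>"
    unfolding c_def using F term_finite by (simp add: less_top)
  have bc: "b z + c * s N z \<le> c" if "z \<in> X" for z
  proof (cases "z \<in> F")
    case True
    have "1 - s N z \<noteq> 0" "1 - s N z < \<infinity>"
      using sN[OF True] ennreal_minus_eq_0[of 1 "s N z"] by (auto simp: less_top[symmetric] ennreal_minus_eq_top)
    then have "b z = b z / (1 - s N z) * (1 - s N z)"
      by (simp add: ennreal_divide_times)
    also have "\<dots> \<le> c * (1 - s N z)"
      unfolding c_def using True F by (intro mult_right_mono member_le_sum) auto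
    finally have "b z + c * s N z \<le> c * (1 - s N z) + c * s N z"
      by (rule add_right_mono)
    also have "\<dots> = c"
      using s_le[of N z] by (simp add: distrib_left[symmetric] diff_add_cancel_ennreal)
    finally show ?thesis .
  next
    case False
    then show ?thesis
      using b(1)[of z] that mult_left_mono[OF s_le[of N z], of c] by simp
  qed
  define h where "h z = (\<Sum>k<N. s k z)" for z
  have h: "h z + s N z = 1 + taboo q x h z" for z
  proof -
    have "taboo q x h z = (\<Sum>k<N. s (Suc k) z)"
      unfolding h_def[abs_def] by (subst taboo_sum) (auto simp: s_def)
    then show ?thesis
      unfolding h_def using sum.lessThan_Suc_shift[of "\<lambda>k. s k z" N] by (simp add: s_def)
  qed
  have h_le: "h z \<le> of_nat N" for z
    unfolding h_def using sum_mono[of "{..<N}" "\<lambda>k. s k z" "\<lambda>_. 1"] s_le by simp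
  define L' where "L' z = L z + c * h z" for z
  have drift': "taboo q x L' z + ennreal \<epsilon> \<le> L' z" if "z \<in> X" for z
  proof -
    have "(taboo q x L' z + ennreal \<epsilon>) + c * s N z = (taboo q x L z + ennreal \<epsilon>) + c * taboo q x h z + c * s N z"
      unfolding L'_def[abs_def] by (simp add: taboo_add taboo_cmult ac_simps)
    also have "\<dots> \<le> (L z + b z) + c * taboo q x h z + c * s N z"
      by (intro add_right_mono drift that)
    also have "\<dots> = L z + c * taboo q x h z + (b z + c * s N z)"
      by (simp add: ac_simps)
    also have "\<dots> \<le> L z + c * taboo q x h z + c"
      by (intro add_left_mono bc that)
    also have "\<dots> = L z + c * (1 + taboo q x h z)"
      by (simp add: distrib_left ac_simps)
    also have "\<dots> = L' z + c * s N z"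
      unfolding h[symmetric] L'_def by (simp add: distrib_left ac_simps)
    finally show ?thesis
      using c s_le[of N z] unfolding add.commute[of _ "c * s N z"] ennreal_add_left_cancel_le
      by (auto simp: ennreal_mult_eq_top_iff less_top[symmetric] top_unique)
  qed
  \<comment> \<open>Telescoping: every jump made before the return consumes \<epsilon> of the
    initial value \<open>L' x\<close>.\<close>
  have iter: "(taboo q x ^^ M) L' x + ennreal \<epsilon> * (\<Sum>m<M. s m x) \<le> L' x" for M
  proof (induction M)
    case (Suc M)
    have "(taboo q x ^^ Suc M) L' x + ennreal \<epsilon> * s M x = (taboo q x ^^ M) (\<lambda>z. taboo q x L' z + ennreal \<epsilon> * 1) x"
      unfolding s_def funpow_Suc_right o_apply by (rule taboo_pow_add_cmult[symmetric])
    also have "\<dots> \<le> (taboo q x ^^ M) L' x"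
      by (rule taboo_pow_mono[where X="\<lambda>_. X"]) (use closed drift' x in auto)
    finally have "(taboo q x ^^ Suc M) L' x + ennreal \<epsilon> * (\<Sum>m<Suc M. s m x)
        \<le> (taboo q x ^^ M) L' x + ennreal \<epsilon> * (\<Sum>m<M. s m x)"
      by (simp add: distrib_left add_mono ac_simps)
    then show ?case using Suc by order
  qed auto
  have "ennreal \<epsilon> * (\<Sum>m. s m x) = (SUP M. ennreal \<epsilon> * (\<Sum>m<M. s m x))"
    by (simp add: suminf_eq_SUP SUP_mult_left_ennreal)
  also have "\<dots> \<le> L' x"
    by (intro SUP_least order_trans[OF _ iter] add_increasing) auto
  also have "\<dots> < \<infinity>"
    unfolding L'_def using L c h_le[of x]
    by (auto simp: ennreal_mult_eq_top_iff less_top[symmetric] top_unique)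
  finally show ?thesis
    using eps unfolding s_def by (auto simp: ennreal_mult_less_top)
qed

section \<open>Drift criteria\<close>

lemma ennreal_inverse_le: "a \<le> b \<Longrightarrow> inverse b \<le> inverse (a::ennreal)"
proof (cases "a = 0")
  case False
  assume "a \<le> b"
  with False show ?thesis
    by (cases a; cases b) (auto simp: inverse_ennreal less_le top_unique intro!: le_imp_inverse_le)
qed simp

lemma taboo_pow_const: "(taboo q x ^^ m) (\<lambda>_. c) z = c * (taboo q x ^^ m) (\<lambda>_. 1) z"
proof (induction m arbitrary: z)
  case (Suc m)
  then have "(taboo q x ^^ m) (\<lambda>_. c) = (\<lambda>z. c * (taboo q x ^^ m) (\<lambda>_. 1) z)"
    by auto
  then show ?case by (simp add: taboo_cmult)
qed auto

text \<open>The deficit \<open>1 - g y\<close> at the atom \<open>y\<close>, times its positive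
  mass, can be added to the integral without exceeding 1.\<close>

lemma nn_integral_pmf_less_1:
  fixes p :: "'s pmf" and g :: "'s \<Rightarrow> ennreal"
  assumes le: "\<And>y. g y \<le> 1" and y: "y \<in> set_pmf p" "g y < 1"
  shows "(\<integral>\<^sup>+y. g y \<partial>p) < 1"
proof -
  have "(\<integral>\<^sup>+z. g z \<partial>p) + (1 - g y) * ennreal (pmf p y) = (\<integral>\<^sup>+z. g z + (1 - g y) * indicator {y} z \<partial>p)"
    by (simp add: nn_integral_add nn_integral_cmult emeasure_pmf_single)
  also have "\<dots> \<le> (\<integral>\<^sup>+z. 1 \<partial>p)"
    using le y(2) by (intro nn_integral_mono) (auto simp: indicator_def add_diff_inverse_ennreal)
  finally have le1: "(\<integral>\<^sup>+z. g z \<partial>p) + (1 - g y) * ennreal (pmf p y) \<le> 1"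
    by simp
  have "0 < (1 - g y) * ennreal (pmf p y)"
    using y by (simp add: ennreal_zero_less_mult_iff diff_gt_0_iff_gt_ennreal pmf_positive)
  moreover have "(\<integral>\<^sup>+z. g z \<partial>p) \<noteq> \<infinity>"
    using le1 by (auto simp: top_unique)
  ultimately show ?thesis
    using le1 ennreal_add_left_cancel_less[of "\<integral>\<^sup>+z. g z \<partial>p" 0 "(1 - g y) * ennreal (pmf p y)"]
    by (metis add_0_right order_less_le_trans)
qed

text \<open>Along a path of positive rates from \<open>z\<close> to \<open>x\<close> the last jump
  is killed, so some mass is lost after as many jumps.\<close>

lemma taboo_pow_less_1:
  assumes nonneg: "\<And>z y. z \<in> X \<Longrightarrow> 0 \<le> q z y"
    and closed: "\<And>z y. z \<in> X \<Longrightarrow> 0 < q z y \<Longrightarrow> y \<in> X"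
    and ne: "\<And>z. z \<in> X \<Longrightarrow> exit_rate q z \<noteq> 0"
    and reach: "\<And>z. z \<in> X \<Longrightarrow> (\<lambda>a b. 0 < q a b)\<^sup>*\<^sup>* z x"
    and z: "z \<in> X"
  shows "\<exists>k. (taboo q x ^^ k) (\<lambda>_. 1) z < 1"
proof -
  have less_1: "\<exists>k. (taboo q x ^^ k) (\<lambda>_. 1) z < 1"
    if "z \<in> X" "0 < q z y" "y \<noteq> z" and y: "y = x \<or> (\<exists>k. (taboo q x ^^ k) (\<lambda>_. 1) y < 1)" for z y
  proof -
    obtain k where k: "y = x \<or> (taboo q x ^^ k) (\<lambda>_. 1) y < 1"
      using y by auto
    have r: "0 < exit_rate q z"
      using exit_rate_nonneg[of q z] ne[OF that(1)] nonneg[OF that(1)] by simp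
    have "y \<in> set_pmf (jump_pmf q z)"
      using pmf_jump_pmf[OF nonneg[OF that(1)] ne[OF that(1)], of y] that r by (simp add: set_pmf_iff)
    then have "taboo q x ((taboo q x ^^ k) (\<lambda>_. 1)) z < 1"
      unfolding taboo_def[of q x "(taboo q x ^^ k) (\<lambda>_. 1)"]
      by (rule nn_integral_pmf_less_1[rotated])
        (use k taboo_pow_1_le[of k q x] in \<open>auto simp: indicator_def\<close>)
    then show ?thesis
      by (intro exI[of _ "Suc k"]) simp
  qed
  have other: "z = x \<or> (\<exists>k. (taboo q x ^^ k) (\<lambda>_. 1) z < 1)" if "z \<in> X" for z
    using reach[OF that] that
  proof (induction rule: converse_rtranclp_induct)
    case (step a b)
    then have "b = x \<or> (\<exists>k. (taboo q x ^^ k) (\<lambda>_. 1) b < 1)"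
      using closed by auto
    with step show ?case
      using less_1[of a b] by (cases "b = a") auto
  qed auto
  \<comment> \<open>For \<open>z = x\<close> the path to \<open>x\<close> may be empty, whereas
    killing acts only from the first jump on. So one jump away from \<open>z\<close> is made before
    following a path.\<close>
  have "\<exists>y. y \<noteq> z \<and> q z y \<noteq> 0"
  proof (rule ccontr)
    assume "\<not> ?thesis"
    then have "exit_rate q z = 0"
      unfolding exit_rate_def by (intro infsum_0) auto
    with ne[OF z] show False by simp
  qed
  then obtain y where y: "y \<noteq> z" "0 < q z y"
    using nonneg[OF z] by (metis less_le)
  show ?thesis
    by (rule less_1[OF z y(2,1)]) (use other closed[OF z y(2)] in auto)
qed

text \<open>Foster's criterion. The exit rates lie between \<open>r\<close> and \<open>R\<close>:
  the upper bound turns a drift \<epsilon> per unit of time into at least \<epsilon> / R per jump,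
  the lower bound limits the mean holding times by 1 / r and so turns the number of jumps back into
  time.\<close>

theorem positive_recurrent_of_drift:
  fixes q :: "'s \<Rightarrow> 's \<Rightarrow> real" and L :: "'s \<Rightarrow> real" and R r \<epsilon> :: real
  assumes nonneg: "\<And>z y. z \<in> X \<Longrightarrow> 0 \<le> q z y"
    and closed: "\<And>z y. z \<in> X \<Longrightarrow> 0 < q z y \<Longrightarrow> y \<in> X"
    and total: "\<And>z. z \<in> X \<Longrightarrow> rate_sum q (\<lambda>_. 1) z = ennreal R"
    and exit: "0 < r" "\<And>z. z \<in> X \<Longrightarrow> r \<le> exit_rate q z"
    and reach: "\<And>z. z \<in> X \<Longrightarrow> (\<lambda>a b. 0 < q a b)\<^sup>*\<^sup>* z x"
    and x: "x \<in> X"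
    and F: "finite F" "F \<subseteq> X" and eps: "0 < \<epsilon>"
    and drift: "\<And>z. z \<in> X - F \<Longrightarrow> rate_sum q (\<lambda>y. ennreal (L y)) z + ennreal \<epsilon> \<le> ennreal R * ennreal (L z)"
    and fin: "\<And>z. z \<in> F \<Longrightarrow> rate_sum q (\<lambda>y. ennreal (L y)) z < \<infinity>"
  shows "positive_recurrent q x"
proof -
  let ?L = "\<lambda>y. ennreal (L y)"
  have ne: "exit_rate q z \<noteq> 0" "0 < exit_rate q z" if "z \<in> X" for z
    using exit(1) exit(2)[OF that] by auto
  have R_eq: "ennreal R = ennreal (exit_rate q z) + ennreal (q z z)" if "z \<in> X" for z
    using rate_sum_eq[OF nonneg ne(1), of z "\<lambda>_. 1"] total[OF that] that by simp
  have R: "exit_rate q z \<le> R" "0 < R" if "z \<in> X" for z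
  proof -
    have "ennreal (exit_rate q z) \<le> ennreal R"
      unfolding R_eq[OF that] by simp
    then show "exit_rate q z \<le> R"
      using ne(2)[OF that] by (auto simp: ennreal_le_iff2)
    with ne(2)[OF that] show "0 < R" by simp
  qed
  \<comment> \<open>On \<open>F\<close> the allowance is the whole left-hand side, so that the
    inequality holds trivially there; \<open>fin\<close> makes it finite.\<close>
  define b where "b z = (if z \<in> F then rate_sum q ?L z + ennreal \<epsilon> else 0)" for z
  have closed': "y \<in> X" if "z \<in> X" "y \<in> set_pmf (jump_pmf q z)" for z y
    using set_jump_pmf[of q z y] closed[of z y] nonneg that by auto
  have S: "(\<Sum>m. (taboo q x ^^ m) (\<lambda>_. 1) x) < \<infinity>"
  proof (rule taboo_sum_finite[where L="?L" and b="\<lambda>z. b z / ennreal r", OF closed' x _ F(1)])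
    show "0 < \<epsilon> / R"
      using eps R x by simp
    show "taboo q x ?L z + ennreal (\<epsilon> / R) \<le> ?L z + b z / ennreal r" if z: "z \<in> X" for z
    proof -
      let ?e = "exit_rate q z"
      have "rate_sum q ?L z + ennreal \<epsilon> \<le> ennreal R * ?L z + b z"
        using drift[of z] z by (auto simp: b_def)
      \<comment> \<open>As \<open>R\<close> is the exit rate plus \<open>q z z\<close>, the diagonal
        term occurs on both sides; cancelling it passes from events to actual jumps.\<close>
      then have "ennreal (q z z) * ?L z + (ennreal ?e * (\<integral>\<^sup>+y. ?L y \<partial>jump_pmf q z) + ennreal \<epsilon>)
          \<le> ennreal (q z z) * ?L z + (ennreal ?e * ?L z + b z)"
        unfolding rate_sum_eq[OF nonneg[OF z] ne(1)[OF z]] R_eq[OF z] distrib_right by (simp add: ac_simps)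
      then have "ennreal ?e * (\<integral>\<^sup>+y. ?L y \<partial>jump_pmf q z) + ennreal \<epsilon> \<le> ennreal ?e * ?L z + b z"
        by (subst (asm) ennreal_add_left_cancel_le) (auto simp: ennreal_mult_eq_top_iff)
      then have "(ennreal ?e * (\<integral>\<^sup>+y. ?L y \<partial>jump_pmf q z) + ennreal \<epsilon>) / ennreal ?e \<le> (ennreal ?e * ?L z + b z) / ennreal ?e"
        by (rule divide_right_mono_ennreal)
      moreover have "ennreal ?e * w / ennreal ?e = w" for w
        using ne(2)[OF z] by (simp add: mult.commute[of "ennreal ?e"] ennreal_times_divide[symmetric])
      ultimately have "(\<integral>\<^sup>+y. ?L y \<partial>jump_pmf q z) + ennreal \<epsilon> / ennreal ?e \<le> ?L z + b z / ennreal ?e"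
        by (simp add: add_divide_distrib_ennreal)
      moreover have "ennreal (\<epsilon> / R) \<le> ennreal \<epsilon> / ennreal ?e"
        using R[OF z] ne(2)[OF z] eps by (simp add: divide_ennreal frac_le)
      moreover have "b z / ennreal ?e \<le> b z / ennreal r"
        unfolding divide_ennreal_def using exit(2)[OF z] exit(1)
        by (intro mult_left_mono) (auto simp: inverse_ennreal le_imp_inverse_le)
      ultimately show ?thesis
        using taboo_le[of q x ?L z] by (meson add_mono order.trans order_refl)
    qed
    show "b z / ennreal r = 0" if "z \<in> X - F" for z
      using that by (simp add: b_def)
    show "b z / ennreal r < \<infinity>" if "z \<in> F" for z
      using fin[OF that] exit(1) by (auto simp: b_def ennreal_divide_eq_top_iff less_top[symmetric])
    show "\<exists>k. (taboo q x ^^ k) (\<lambda>_. 1) z < 1" if "z \<in> F" for z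
      by (rule taboo_pow_less_1[of X]) (use nonneg closed ne reach that F(2) in auto)
  qed simp_all
  have "(\<integral>\<^sup>+\<omega>. return_time q x \<omega> \<partial>path_measure q x)
      \<le> (\<Sum>m. (taboo q x ^^ m) (\<lambda>z. inverse (ennreal (exit_rate q z))) x)"
    using S by (intro expected_return_time_le) auto
  also have "\<dots> \<le> (\<Sum>m. ennreal (1 / r) * (taboo q x ^^ m) (\<lambda>_. 1) x)"
  proof (rule suminf_le)
    fix m
    have "(taboo q x ^^ m) (\<lambda>z. inverse (ennreal (exit_rate q z))) x
        \<le> (taboo q x ^^ m) (\<lambda>z. ennreal (1 / r)) x"
    proof (rule taboo_pow_mono[where X="\<lambda>_. X", OF closed' _ x])
      show "inverse (ennreal (exit_rate q y)) \<le> ennreal (1 / r)" if "y \<in> X" for y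
        using exit(1) exit(2)[OF that] by (simp add: inverse_ennreal divide_inverse le_imp_inverse_le)
    qed
    also have "\<dots> = ennreal (1 / r) * (taboo q x ^^ m) (\<lambda>_. 1) x"
      by (rule taboo_pow_const)
    finally show "(taboo q x ^^ m) (\<lambda>z. inverse (ennreal (exit_rate q z))) x
        \<le> ennreal (1 / r) * (taboo q x ^^ m) (\<lambda>_. 1) x" .
  qed auto
  also have "\<dots> < \<infinity>"
    using S by (simp add: ennreal_mult_less_top)
  finally show ?thesis
    unfolding positive_recurrent_def by simp
qed

text \<open>Because \<open>N x = 0\<close>, killing at \<open>x\<close> discards nothing of
  \<open>N\<close>, and the submartingale inequality carries over to \<open>taboo q x\<close>. Every
  holding time has mean at least 1 / R, so a divergent mean number of jumps gives an infinite mean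
  return time. No strictly positive drift is required.\<close>

theorem not_positive_recurrent_of_drift:
  fixes q :: "'s \<Rightarrow> 's \<Rightarrow> real" and N :: "'s \<Rightarrow> nat" and R :: real
  assumes nonneg: "\<And>z y. z \<in> X \<Longrightarrow> 0 \<le> q z y"
    and closed: "\<And>z y. z \<in> X \<Longrightarrow> 0 < q z y \<Longrightarrow> y \<in> X"
    and total: "\<And>z. z \<in> X \<Longrightarrow> rate_sum q (\<lambda>_. 1) z = ennreal R"
    and x: "x \<in> X" "exit_rate q x \<noteq> 0" "N x = 0"
    and step: "\<And>z y. z \<in> X \<Longrightarrow> 0 < q z y \<Longrightarrow> N y \<le> Suc (N z)"
    and drift: "\<And>z. z \<in> X \<Longrightarrow> ennreal R * of_nat (N z) \<le> rate_sum q (\<lambda>y. of_nat (N y)) z"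
    and start: "0 < rate_sum q (\<lambda>y. of_nat (N y)) x"
  shows "\<not> positive_recurrent q x"
proof
  assume pos: "positive_recurrent q x"
  let ?N = "\<lambda>y. of_nat (N y) :: ennreal"
  have jump: "(z \<in> X \<Longrightarrow> y \<in> set_pmf (jump_pmf q z) \<Longrightarrow> y \<in> X)"
    "(z \<in> X \<Longrightarrow> y \<in> set_pmf (jump_pmf q z) \<Longrightarrow> N y \<le> Suc (N z))" for z y
    using set_jump_pmf[of q z y] closed[of z y] nonneg step[of z y] by auto
  have R_eq: "ennreal R = ennreal (exit_rate q z) + ennreal (q z z)" if "z \<in> X" "exit_rate q z \<noteq> 0" for z
    using rate_sum_eq[OF nonneg that(2), of "\<lambda>_. 1"] total[OF that(1)] that by simp
  have exit_le: "ennreal (exit_rate q z) \<le> ennreal R" if "z \<in> X" for z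
    using R_eq[OF that] by (cases "exit_rate q z = 0") auto
  have exit_x: "0 < exit_rate q x"
    using exit_rate_nonneg[of q x] nonneg x by simp
  have R: "0 < R"
    using exit_le[OF x(1)] exit_x by (metis ennreal_le_iff2 not_le order_less_le_trans)
  have taboo_N: "taboo q x ?N z = (\<integral>\<^sup>+y. ?N y \<partial>jump_pmf q z)" for z
    unfolding taboo_def using x(3) by (intro nn_integral_cong) (auto simp: indicator_def)
  have up: "?N z \<le> taboo q x ?N z" if z: "z \<in> X" for z
  proof (cases "exit_rate q z = 0")
    case True
    then show ?thesis
      unfolding taboo_N by (simp add: jump_pmf_def)
  next
    case False
    let ?e = "exit_rate q z"
    have "ennreal (q z z) * ?N z + ennreal ?e * ?N z
        \<le> ennreal (q z z) * ?N z + ennreal ?e * (\<integral>\<^sup>+y. ?N y \<partial>jump_pmf q z)"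
      using drift[OF z] unfolding rate_sum_eq[OF nonneg[OF z] False] R_eq[OF z False] distrib_right
      by (simp add: add.commute)
    then have "ennreal ?e * ?N z \<le> ennreal ?e * (\<integral>\<^sup>+y. ?N y \<partial>jump_pmf q z)"
      by (subst (asm) ennreal_add_left_cancel_le) (auto simp: ennreal_mult_eq_top_iff)
    moreover have "0 < ?e"
      using False exit_rate_nonneg[of q z] nonneg[OF z] by simp
    ultimately show ?thesis
      unfolding taboo_N by (simp add: ennreal_mult_le_mult_iff)
  qed
  define a where "a = taboo q x ?N x"
  have a_pos: "0 < a"
    using start x(3) unfolding rate_sum_eq[OF nonneg[OF x(1)] x(2)] a_def taboo_N
    by (simp add: ennreal_zero_less_mult_iff)
  \<comment> \<open>The bound needs at least one jump, since the zeroth power gives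
    \<open>N x = 0\<close>; hence the shift to \<open>Suc m\<close>, which also keeps the harmonic
    terms defined.\<close>
  have a_le: "a \<le> (taboo q x ^^ Suc m) ?N x" for m
  proof (induction m)
    case (Suc m)
    have "(taboo q x ^^ Suc m) ?N x \<le> (taboo q x ^^ Suc m) (taboo q x ?N) x"
      by (rule taboo_pow_mono[where X="\<lambda>_. X", OF jump(1) up x(1)])
    then show ?case
      using Suc unfolding funpow_Suc_right[of "Suc m"] o_apply by order
  qed (simp add: a_def)
  \<comment> \<open>The family of sets is {z. N z \<le> m}: starting from 0, \<open>N\<close> gains
    at most 1 per jump.\<close>
  have "(taboo q x ^^ m) ?N x \<le> (taboo q x ^^ m) (\<lambda>_. of_nat m) x" for m
    by (rule taboo_pow_mono[where X="\<lambda>m. {z\<in>X. N z \<le> m}" and n=0]) (use jump x in \<open>force+\<close>)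
  moreover have "(taboo q x ^^ m) (\<lambda>_. of_nat m) x = of_nat m * (taboo q x ^^ m) (\<lambda>_. 1) x" for m
    by (rule taboo_pow_const)
  ultimately have N_le: "(taboo q x ^^ m) ?N x \<le> of_nat m * (taboo q x ^^ m) (\<lambda>_. 1) x" for m
    by metis
  have s_ge: "a * ennreal (1 / Suc m) \<le> (taboo q x ^^ Suc m) (\<lambda>_. 1) x" for m
  proof -
    have "a * ennreal (1 / Suc m) \<le> of_nat (Suc m) * (taboo q x ^^ Suc m) (\<lambda>_. 1) x * ennreal (1 / Suc m)"
      using order_trans[OF a_le N_le] by (rule mult_right_mono) simp
    also have "\<dots> = (of_nat (Suc m) * ennreal (1 / Suc m)) * (taboo q x ^^ Suc m) (\<lambda>_. 1) x"
      by (simp only: ac_simps)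
    also have "of_nat (Suc m) * ennreal (1 / Suc m) = 1"
      by (simp only: ennreal_of_nat_eq_real_of_nat ennreal_mult'[symmetric]) simp
    finally show ?thesis by simp
  qed
  have h_ge: "ennreal (1 / R) * (taboo q x ^^ m) (\<lambda>_. 1) x
      \<le> (taboo q x ^^ m) (\<lambda>z. inverse (ennreal (exit_rate q z))) x" for m
  proof -
    have "ennreal (1 / R) * (taboo q x ^^ m) (\<lambda>_. 1) x = (taboo q x ^^ m) (\<lambda>_. ennreal (1 / R)) x"
      by (rule taboo_pow_const[symmetric])
    also have "\<dots> \<le> (taboo q x ^^ m) (\<lambda>z. inverse (ennreal (exit_rate q z))) x"
    proof (rule taboo_pow_mono[where X="\<lambda>_. X", OF jump(1) _ x(1)])
      fix z assume "z \<in> X"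
      have "ennreal (1 / R) = inverse (ennreal R)"
        using R by (simp add: inverse_ennreal divide_inverse)
      also have "\<dots> \<le> inverse (ennreal (exit_rate q z))"
        by (rule ennreal_inverse_le[OF exit_le[OF \<open>z \<in> X\<close>]])
      finally show "ennreal (1 / R) \<le> inverse (ennreal (exit_rate q z))"
        by simp
    qed
    finally show ?thesis .
  qed
  have "(\<integral>\<^sup>+\<omega>. return_time q x \<omega> \<partial>path_measure q x) < \<infinity>"
    using pos x(2) unfolding positive_recurrent_def by auto
  then have fin: "(\<Sum>m. (taboo q x ^^ m) (\<lambda>z. inverse (ennreal (exit_rate q z))) x) < \<infinity>"
    using expected_return_time_ge by (rule le_less_trans[rotated])
  have "(ennreal (1 / R) * a) * (\<Sum>m. ennreal (1 / Suc m)) = (\<Sum>m. (ennreal (1 / R) * a) * ennreal (1 / Suc m))"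
    by (rule ennreal_suminf_cmult[symmetric])
  also have "\<dots> \<le> (\<Sum>m. (taboo q x ^^ Suc m) (\<lambda>z. inverse (ennreal (exit_rate q z))) x)"
    using order_trans[OF mult_left_mono[OF s_ge, of "ennreal (1 / R)"] h_ge]
    by (intro suminf_le) (simp_all add: mult.assoc del: funpow.simps)
  also have "\<dots> \<le> (\<Sum>m. (taboo q x ^^ m) (\<lambda>z. inverse (ennreal (exit_rate q z))) x)"
    by (subst suminf_offset[where i=1 and f="\<lambda>m. (taboo q x ^^ m) (\<lambda>z. inverse (ennreal (exit_rate q z))) x"]) auto
  finally have "(ennreal (1 / R) * a) * (\<Sum>m. ennreal (1 / Suc m)) < \<infinity>"
    using fin by order
  then have "(\<Sum>m. ennreal (1 / Suc m)) \<noteq> \<infinity>"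
    using a_pos R by (auto simp: ennreal_mult_less_top)
  then have "summable (\<lambda>m. 1 / real (Suc m))"
    by (intro summable_suminf_not_top) auto
  then show False
    using not_summable_harmonic[where 'a=real] summable_Suc_iff[of "\<lambda>m. inverse (real m)"]
    by (simp add: divide_inverse)
qed

section \<open>Transitions of the network\<close>

text \<open>\<open>exit_rate\<close> is an \<open>infsum\<close>, which defaults to 0 for a family
  that is not summable; the finite total rate supplies summability.\<close>

lemma le_exit_rate:
  assumes nonneg: "\<And>y. 0 \<le> q z y" and fin: "rate_sum q (\<lambda>_. 1) z < \<infinity>" and "y \<noteq> z"
  shows "q z y \<le> exit_rate q z"
proof -
  have "integrable (count_space UNIV) (q z)"
    using nonneg fin by (intro integrableI_nonneg) (auto simp: rate_sum_def)
  then have "Infinite_Set_Sum.abs_summable_on (q z) UNIV"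
    by (simp add: abs_summable_on_def)
  then have "(\<lambda>y. norm (q z y)) summable_on UNIV"
    by (simp only: abs_summable_equivalent)
  then have "q z summable_on (UNIV - {z})"
    using nonneg by (auto intro: summable_on_subset_banach)
  then have "sum (q z) {y} \<le> infsum (q z) (UNIV - {z})"
    by (rule finite_sum_le_infsum) (use nonneg \<open>y \<noteq> z\<close> in auto)
  then show ?thesis
    by (simp add: exit_rate_def)
qed

definition delivered :: "'v config \<Rightarrow> 'v \<Rightarrow> nat option \<Rightarrow> 'v config" where
  "delivered x v r = (case r of None \<Rightarrow> x | Some j \<Rightarrow> transmit x v j)"

lemma delivered_simps [simp]: "delivered x v None = x" "delivered x v (Some j) = transmit x v j"
  by (simp_all add: delivered_def)

lemma network_rate_eq:
  "network_rate V E c lam d x y = (\<Sum>u\<in>V. lam u * of_bool (arrive V x u = y)) +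
     (\<Sum>e\<in>E. c e * pmf (map_pmf (delivered x (snd e)) (d x e)) y)"
  by (simp add: network_rate_def case_prod_beta delivered_def[abs_def])

locale broadcast_network =
  fixes V :: "'v set" and E :: "('v \<times> 'v) set" and c :: "'v \<times> 'v \<Rightarrow> real" and lam :: "'v \<Rightarrow> real"
  assumes finV: "finite V" and E: "E \<subseteq> V \<times> V"
    and c_pos: "\<And>e. e \<in> E \<Longrightarrow> 0 < c e" and lam_nonneg: "\<And>u. u \<in> V \<Longrightarrow> 0 \<le> lam u"
begin

lemma finite_links: "finite E"
  using E finV by (meson finite_SigmaI finite_subset)

lemma network_rate_nonneg: "0 \<le> network_rate V E c lam d x y"
  unfolding network_rate_eq
  by (intro add_nonneg_nonneg sum_nonneg mult_nonneg_nonneg less_imp_le[OF c_pos]) (auto simp: lam_nonneg)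

text \<open>A rate adds up all events with the same outcome. Summing over outcomes undoes this
  grouping, so \<open>f\<close> is evaluated event by event even if different events lead to one
  configuration.\<close>

lemma rate_sum_network:
  "rate_sum (network_rate V E c lam d) f x =
    (\<Sum>u\<in>V. ennreal (lam u) * f (arrive V x u)) +
    (\<Sum>e\<in>E. ennreal (c e) * (\<integral>\<^sup>+r. f (delivered x (snd e) r) \<partial>d x e))"
proof -
  have A: "ennreal (network_rate V E c lam d x y) * f y =
      (\<Sum>u\<in>V. ennreal (lam u) * (f y * indicator {arrive V x u} y)) +
      (\<Sum>e\<in>E. ennreal (c e) * (ennreal (pmf (map_pmf (delivered x (snd e)) (d x e)) y) * f y))" for y
  proof -
    have "ennreal (network_rate V E c lam d x y) =
      (\<Sum>u\<in>V. ennreal (lam u) * of_bool (arrive V x u = y)) +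
      (\<Sum>e\<in>E. ennreal (c e) * ennreal (pmf (map_pmf (delivered x (snd e)) (d x e)) y))"
      unfolding network_rate_eq
      by (subst ennreal_plus, (intro sum_nonneg mult_nonneg_nonneg less_imp_le[OF c_pos]; simp add: lam_nonneg)+)
        (auto simp: sum_ennreal[symmetric] lam_nonneg less_imp_le[OF c_pos] ennreal_mult' intro!: arg_cong2[where f="(+)"] sum.cong)
    then show ?thesis
      by (auto simp: distrib_right sum_distrib_right mult.assoc indicator_def intro!: arg_cong2[where f="(+)"] sum.cong)
  qed
  show ?thesis
    unfolding rate_sum_def A
    by (subst nn_integral_add)
      (auto simp: nn_integral_sum nn_integral_cmult nn_integral_measure_pmf[symmetric] one_ennreal_def[symmetric])
qed

lemma rate_sum_network_1:
  "rate_sum (network_rate V E c lam d) (\<lambda>_. 1) x = ennreal ((\<Sum>u\<in>V. lam u) + (\<Sum>e\<in>E. c e))"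
  unfolding rate_sum_network
  by (subst ennreal_plus) (auto simp: sum_ennreal lam_nonneg less_imp_le[OF c_pos] intro!: sum_nonneg)

lemma network_rate_pos_cases [consumes 1, case_names arrive deliver]:
  assumes "0 < network_rate V E c lam d x y"
  obtains (arrive) u where "u \<in> V" "0 < lam u" "y = arrive V x u"
    | (deliver) u v r where "(u, v) \<in> E" "r \<in> set_pmf (d x (u, v))" "y = delivered x v r"
proof -
  have "\<not> ((\<forall>u\<in>V. lam u * of_bool (arrive V x u = y) \<le> 0) \<and>
      (\<forall>e\<in>E. c e * pmf (map_pmf (delivered x (snd e)) (d x e)) y \<le> 0))"
  proof
    assume *: "(\<forall>u\<in>V. lam u * of_bool (arrive V x u = y) \<le> 0) \<and>
      (\<forall>e\<in>E. c e * pmf (map_pmf (delivered x (snd e)) (d x e)) y \<le> 0)"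
    have "network_rate V E c lam d x y \<le> 0"
      unfolding network_rate_eq using * by (intro add_nonpos_nonpos sum_nonpos) auto
    with assms show False by simp
  qed
  then consider u where "u \<in> V" "0 < lam u * of_bool (arrive V x u = y)"
    | e where "e \<in> E" "0 < c e * pmf (map_pmf (delivered x (snd e)) (d x e)) y"
    by (meson not_le)
  then show thesis
  proof cases
    case 1
    then show ?thesis using arrive[of u] by (cases "arrive V x u = y") auto
  next
    case 2
    then have "0 < pmf (map_pmf (delivered x (snd e)) (d x e)) y"
      using c_pos zero_less_mult_pos by blast
    then have "y \<in> set_pmf (map_pmf (delivered x (snd e)) (d x e))"
      by (simp add: set_pmf_iff del: set_map_pmf)
    then show ?thesis
      using deliver[of "fst e" "snd e"] 2(1) by auto
  qed
qed

lemma network_rate_arrive: "u \<in> V \<Longrightarrow> lam u \<le> network_rate V E c lam d x (arrive V x u)"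
proof -
  assume u: "u \<in> V"
  have "lam u * of_bool (arrive V x u = arrive V x u) \<le> (\<Sum>w\<in>V. lam w * of_bool (arrive V x w = arrive V x u))"
    using u finV by (intro member_le_sum[of u V "\<lambda>w. lam w * of_bool (arrive V x w = arrive V x u)"]) (auto simp: lam_nonneg)
  moreover have "0 \<le> (\<Sum>e\<in>E. c e * pmf (map_pmf (delivered x (snd e)) (d x e)) (arrive V x u))"
    by (intro sum_nonneg mult_nonneg_nonneg less_imp_le[OF c_pos]) auto
  ultimately show ?thesis
    unfolding network_rate_eq by simp
qed

lemma network_rate_deliver:
  assumes "(u, v) \<in> E" "r \<in> set_pmf (d x (u, v))"
  shows "0 < network_rate V E c lam d x (delivered x v r)"
proof -
  let ?g = "\<lambda>e. c e * pmf (map_pmf (delivered x (snd e)) (d x e)) (delivered x v r)"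
  have "delivered x v r \<in> set_pmf (map_pmf (delivered x v) (d x (u, v)))"
    using assms(2) by auto
  then have "0 < ?g (u, v)"
    using c_pos[OF assms(1)] by (simp add: pmf_positive)
  also have "\<dots> \<le> sum ?g E"
    by (intro member_le_sum[OF assms(1)] mult_nonneg_nonneg finite_links) (auto intro: less_imp_le[OF c_pos])
  also have "\<dots> \<le> network_rate V E c lam d x (delivered x v r)"
    unfolding network_rate_eq by (simp add: sum_nonneg lam_nonneg)
  finally show ?thesis .
qed

end

section \<open>Holders of packets, confined packets, and relabelling\<close>

definition holders :: "'v set \<Rightarrow> 'v config \<Rightarrow> nat \<Rightarrow> 'v set" where
  "holders V x j = {v \<in> V. \<forall>u. j \<notin> x u v}"

text \<open>Invariant of the reachable configurations. Consecutive labels make the next label fresh;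
  a holder for each packet means that nothing is confined to the empty set and that the cut
  condition applies to the set of holders.\<close>

definition valid :: "'v set \<Rightarrow> 'v config \<Rightarrow> bool" where
  "valid V x \<longleftrightarrow> (\<forall>a b. x a b \<noteq> {} \<longrightarrow> a \<in> V \<and> b \<in> V) \<and>
     packets x = {1..card (packets x)} \<and> (\<forall>j\<in>packets x. holders V x j \<noteq> {})"

text \<open>Its cardinality is the occupancy of \<open>S\<close>, the quantity on which both
  directions rest.\<close>

definition confined :: "'v set \<Rightarrow> 'v config \<Rightarrow> 'v set \<Rightarrow> nat set" where
  "confined V x S = {j \<in> packets x. holders V x j \<subseteq> S}"

lemma valid_empty_config: "valid V empty_config"
  by (auto simp: valid_def empty_config_def packets_def)

lemma holders_subset: "holders V x j \<subseteq> V"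
  by (auto simp: holders_def)

lemma finite_packets: "valid V x \<Longrightarrow> finite (packets x)"
  unfolding valid_def by (metis finite_atLeastAtMost)

lemma packets_eq: "valid V x \<Longrightarrow> packets x = {1..card (packets x)}"
  by (simp add: valid_def)

lemma packets_iff_holders:
  assumes "\<And>a b. x a b \<noteq> {} \<Longrightarrow> b \<in> V"
  shows "j \<in> packets x \<longleftrightarrow> holders V x j \<noteq> V"
proof -
  have "j \<in> packets x \<longleftrightarrow> (\<exists>b\<in>V. \<exists>a. j \<in> x a b)"
    unfolding packets_def using assms by blast
  also have "\<dots> \<longleftrightarrow> holders V x j \<noteq> V"
    unfolding holders_def by blast
  finally show ?thesis .
qed

lemma packets_iff: "valid V x \<Longrightarrow> j \<in> packets x \<longleftrightarrow> holders V x j \<noteq> V"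
  by (rule packets_iff_holders) (simp add: valid_def)

lemma finite_confined: "valid V x \<Longrightarrow> finite (confined V x S)"
  using finite_packets[of V x] by (simp add: confined_def)

lemma available_eq: "v \<in> V \<Longrightarrow> available x v = {j \<in> packets x. v \<in> holders V x j}"
  by (auto simp: available_def holders_def)

lemma arrive_trivial: "V \<subseteq> {u} \<Longrightarrow> arrive V x u = x"
  by (auto simp: arrive_def fun_eq_iff)

lemma holders_arrive:
  assumes "u \<in> V"
  shows "holders V (arrive V x u) i =
    (if i = card (packets x) + 1 then holders V x i \<inter> {u} else holders V x i)"
  using assms by (auto simp: holders_def arrive_def split: if_splits)

lemma packets_arrive:
  assumes "w \<in> V" "w \<noteq> u"
  shows "packets (arrive V x u) = insert (card (packets x) + 1) (packets x)"
proof -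
  let ?x = "arrive V x u"
  have "?x a b \<subseteq> insert (card (packets x) + 1) (packets x)" "x a b \<subseteq> ?x a b" for a b
    by (auto simp: arrive_def packets_def)
  moreover have "card (packets x) + 1 \<in> ?x u w"
    using assms by (simp add: arrive_def)
  ultimately show ?thesis
    unfolding packets_def[of ?x] packets_def[of x, symmetric] by (fastforce simp: packets_def)
qed

text \<open>A label not in use is missing nowhere and thus counts as held by all of
  \<open>V\<close>. With \<open>holders_arrive\<close> this gives the new packet its source as only
  holder.\<close>

lemma new_label:
  assumes "valid V x"
  shows "card (packets x) + 1 \<notin> packets x" "holders V x (card (packets x) + 1) = V"
proof -
  show *: "card (packets x) + 1 \<notin> packets x"
    using packets_eq[OF assms] by (metis atLeastAtMost_iff Suc_eq_plus1 not_less_eq_eq order_refl)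
  show "holders V x (card (packets x) + 1) = V"
    using packets_iff[OF assms] * by blast
qed

lemma valid_arrive:
  assumes x: "valid V x" and u: "u \<in> V"
  shows "valid V (arrive V x u)"
proof (cases "V \<subseteq> {u}")
  case True
  then show ?thesis using x by (simp add: arrive_trivial)
next
  case False
  then obtain w where w: "w \<in> V" "w \<noteq> u" by auto
  let ?k = "card (packets x) + 1"
  have "packets (arrive V x u) = {1..?k}"
    unfolding packets_arrive[OF w] by (subst packets_eq[OF x]) auto
  moreover have "holders V (arrive V x u) j \<noteq> {}" if "j \<in> packets (arrive V x u)" for j
    using that x u new_label[OF x] unfolding packets_arrive[OF w] holders_arrive[OF u] by (auto simp: valid_def)
  moreover have "a \<in> V \<and> b \<in> V" if "arrive V x u a b \<noteq> {}" for a b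
    using that x u by (auto simp: arrive_def valid_def split: if_splits)
  ultimately show ?thesis
    unfolding valid_def by simp
qed

lemma card_confined_arrive:
  assumes x: "valid V x" and u: "u \<in> V" and S: "S \<subset> V"
  shows "card (confined V (arrive V x u) S) = card (confined V x S) + of_bool (u \<in> S)"
proof (cases "V \<subseteq> {u}")
  case True
  then have "u \<notin> S" using S u by auto
  with True show ?thesis by (simp add: arrive_trivial)
next
  case False
  then obtain w where w: "w \<in> V" "w \<noteq> u" by auto
  let ?k = "card (packets x) + 1"
  have "confined V (arrive V x u) S = (if u \<in> S then insert ?k (confined V x S) else confined V x S)"
    using new_label[OF x] u unfolding confined_def packets_arrive[OF w] holders_arrive[OF u] by auto
  moreover have "?k \<notin> confined V x S"
    using new_label[OF x] by (simp add: confined_def)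
  ultimately show ?thesis
    using finite_confined[OF x, of S] by simp
qed

text \<open>The effect of a transmission before a complete packet is removed and the labels are
  shifted; holders are easy to follow here.\<close>

definition acquire :: "'v config \<Rightarrow> 'v \<Rightarrow> nat \<Rightarrow> 'v config" where
  "acquire x v j = (\<lambda>a b. if b = v then x a b - {j} else x a b)"

lemma transmit_eq:
  "transmit x v j = (if j \<in> packets (acquire x v j) then acquire x v j else depart j (acquire x v j))"
  by (simp add: transmit_def acquire_def Let_def)

lemma holders_acquire:
  "v \<in> V \<Longrightarrow> holders V (acquire x v j) i = (if i = j then insert v (holders V x i) else holders V x i)"
  by (auto simp: holders_def acquire_def)

lemma packets_acquire:
  assumes x: "valid V x" and "v \<in> V"
  shows "i \<in> packets (acquire x v j) \<longleftrightarrow> holders V (acquire x v j) i \<noteq> V"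
  by (rule packets_iff_holders) (use x in \<open>auto simp: valid_def acquire_def split: if_splits\<close>)

lemma packets_acquire_subset: "packets (acquire x v j) \<subseteq> packets x" "packets x \<subseteq> insert j (packets (acquire x v j))"
proof -
  show "packets (acquire x v j) \<subseteq> packets x"
    unfolding packets_def by (intro UN_mono) (auto simp: acquire_def)
  have "i \<in> packets (acquire x v j)" if "i \<in> x a b" "i \<noteq> j" for i a b
    using that unfolding packets_def by (intro UN_I[of a] UN_I[of b]) (auto simp: acquire_def)
  then show "packets x \<subseteq> insert j (packets (acquire x v j))"
    unfolding packets_def[of x] by blast
qed

text \<open>A further holder inside \<open>S\<close> does not affect inclusion in \<open>S\<close>,
  and a packet with all holders in \<open>S\<close> remains incomplete because \<open>S\<close> is a
  strict subset. A holder outside \<open>S\<close> ends confinement.\<close>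

lemma confined_acquire:
  assumes x: "valid V x" and v: "v \<in> V" and S: "S \<subset> V"
  shows "confined V (acquire x v j) S = confined V x S - (if v \<in> S then {} else {j})"
proof (rule set_eqI)
  fix i
  show "i \<in> confined V (acquire x v j) S \<longleftrightarrow> i \<in> confined V x S - (if v \<in> S then {} else {j})"
    using S holders_subset[of V x i]
    unfolding confined_def mem_Collect_eq packets_acquire[OF x v] packets_iff[OF x] Diff_iff holders_acquire[OF v]
    by (auto split: if_splits)
qed

definition relabel :: "nat \<Rightarrow> nat \<Rightarrow> nat" where
  "relabel j i = (if i > j then i - 1 else i)"

text \<open>Both \<open>j\<close> and \<open>j + 1\<close> are sent to \<open>j\<close>, so the
  departed label has to be excluded.\<close>

lemma inj_on_relabel: "inj_on (relabel j) (- {j})"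
  by (auto simp: inj_on_def relabel_def split: if_splits)

lemma relabel_image:
  assumes "1 \<le> j" "j \<le> k"
  shows "relabel j ` ({1..k} - {j}) = {1..k - 1}"
proof (rule set_eqI)
  fix i
  show "i \<in> relabel j ` ({1..k} - {j}) \<longleftrightarrow> i \<in> {1..k - 1}"
  proof
    assume "i \<in> {1..k - 1}"
    then show "i \<in> relabel j ` ({1..k} - {j})"
      using assms by (intro image_eqI[of _ _ "if i < j then i else i + 1"]) (auto simp: relabel_def)
  qed (use assms in \<open>auto simp: relabel_def split: if_splits\<close>)
qed

lemma depart_eq: "depart j x = (\<lambda>a b. relabel j ` x a b)"
  by (simp add: depart_def relabel_def[abs_def])

lemma packets_depart: "packets (depart j x) = relabel j ` packets x"
  by (auto simp: packets_def depart_eq)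

lemma holders_depart:
  assumes "j \<notin> packets x" "i \<noteq> j"
  shows "holders V (depart j x) (relabel j i) = holders V x i"
proof -
  have "relabel j i \<in> relabel j ` x a b \<longleftrightarrow> i \<in> x a b" for a b
    using assms inj_on_image_mem_iff[OF inj_on_relabel[of j], of i "x a b"] by (auto simp: packets_def)
  then show ?thesis
    by (simp add: holders_def depart_eq)
qed

lemma confined_depart:
  assumes "j \<notin> packets x"
  shows "confined V (depart j x) S = relabel j ` confined V x S"
proof -
  have "holders V (depart j x) (relabel j i) = holders V x i" if "i \<in> packets x" for i
    using that assms by (intro holders_depart) auto
  then show ?thesis
    by (auto simp: confined_def packets_depart)
qed

text \<open>A departure only renames the remaining packets, injectively. Working with cardinalities
  makes the case of a completed packet disappear from all later arguments.\<close>

lemma card_confined_transmit: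
  assumes x: "valid V x" and v: "v \<in> V" and S: "S \<subset> V"
  shows "card (confined V (transmit x v j) S) = card (confined V x S - (if v \<in> S then {} else {j}))"
proof (cases "j \<in> packets (acquire x v j)")
  case True
  then show ?thesis
    by (simp add: transmit_eq confined_acquire[OF x v S])
next
  case False
  then have "inj_on (relabel j) (confined V (acquire x v j) S)"
    by (intro inj_on_subset[OF inj_on_relabel]) (auto simp: confined_def)
  then show ?thesis
    using False by (simp add: transmit_eq confined_depart card_image confined_acquire[OF x v S])
qed

lemma valid_transmit:
  assumes x: "valid V x" and v: "v \<in> V" and j: "j \<in> packets x"
  shows "valid V (transmit x v j)"
proof -
  let ?x = "acquire x v j"
  have supp: "a \<in> V \<and> b \<in> V" if "?x a b \<noteq> {}" for a b
    using that x by (auto simp: acquire_def valid_def split: if_splits)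
  have hold: "holders V ?x i \<noteq> {}" if "i \<in> packets ?x" for i
    using that packets_acquire_subset(1)[of x v j] x unfolding holders_acquire[OF v] by (auto simp: valid_def)
  show ?thesis
  proof (cases "j \<in> packets ?x")
    case True
    then have "packets ?x = packets x"
      using packets_acquire_subset[where x=x and v=v and j=j] by auto
    with True show ?thesis
      using supp hold packets_eq[OF x] unfolding valid_def transmit_eq by simp
  next
    case False
    let ?k = "card (packets x)"
    have jk: "1 \<le> j" "j \<le> ?k"
      using j packets_eq[OF x] by (metis atLeastAtMost_iff)+
    have "packets ?x = {1..?k} - {j}"
      using False packets_acquire_subset[where x=x and v=v and j=j] packets_eq[OF x] by auto
    then have P: "packets (depart j ?x) = {1..?k - 1}"
      by (simp only: packets_depart relabel_image[OF jk])
    have "holders V (depart j ?x) i \<noteq> {}" if i: "i \<in> packets (depart j ?x)" for i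
    proof -
      obtain i' where i': "i' \<in> packets ?x" "i = relabel j i'"
        using i by (auto simp: packets_depart)
      then have "i' \<noteq> j" using False by auto
      then show ?thesis
        using hold[OF i'(1)] holders_depart[OF False] i'(2) by simp
    qed
    moreover have "a \<in> V \<and> b \<in> V" if "depart j ?x a b \<noteq> {}" for a b
      using that supp by (auto simp: depart_eq)
    ultimately show ?thesis
      using False P unfolding valid_def transmit_eq by simp
  qed
qed

section \<open>Necessity of the cut condition\<close>

text \<open>
  Weaker than \<^const>\<open>admissible\<close>, which need not hold for \<^const>\<open>random_useful\<close>: the law
  \<^const>\<open>pmf_of_set\<close> of an infinite set of useful packets is unspecified.
\<close>

definition admissible_on_valid :: "'v set \<Rightarrow> ('v \<times> 'v) set \<Rightarrow> 'v discipline \<Rightarrow> bool" where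
  "admissible_on_valid V E d \<longleftrightarrow>
     (\<forall>x u v. valid V x \<longrightarrow> (u, v) \<in> E \<longrightarrow> set_pmf (d x (u, v)) \<subseteq> insert None (Some ` available x u))"

lemma finite_useful: "valid V x \<Longrightarrow> finite (useful x e)"
  using finite_packets[of V x] by (cases e) (auto simp: useful_def available_def)

lemma set_random_useful:
  assumes "valid V x"
  shows "set_pmf (random_useful x e) = (if useful x e = {} then {None} else Some ` useful x e)"
  using finite_useful[OF assms] by (simp add: random_useful_def)

lemma admissible_random_useful: "admissible_on_valid V E random_useful"
  unfolding admissible_on_valid_def by (auto simp: set_random_useful useful_def)

lemma useful_eq:
  assumes "u \<in> V" "v \<in> V"
  shows "useful x (u, v) = {j \<in> packets x. u \<in> holders V x j \<and> v \<notin> holders V x j}"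
  using assms by (auto simp: useful_def available_eq)

lemma packets_empty_iff: "packets x = {} \<longleftrightarrow> x = empty_config"
  by (auto simp: packets_def empty_config_def fun_eq_iff)

text \<open>With at most \<open>n\<close> packets all labels lie in {1..n}, and entries outside
  \<open>V\<close> are empty. This yields the finite exceptional set of the drift criterion.\<close>

lemma finite_valid_configs:
  assumes "finite V"
  shows "finite {x. valid V x \<and> card (packets x) \<le> n}"
proof (rule finite_subset)
  let ?B = "{f :: 'a \<Rightarrow> nat set. \<forall>b. (b \<in> V \<longrightarrow> f b \<in> Pow {1..n}) \<and> (b \<notin> V \<longrightarrow> f b = {})}"
  have "finite ?B"
    by (rule finite_set_of_finite_funs) (use assms in auto)
  then show "finite {x :: 'a config. \<forall>a. (a \<in> V \<longrightarrow> x a \<in> ?B) \<and> (a \<notin> V \<longrightarrow> x a = (\<lambda>_. {}))}"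
    by (rule finite_set_of_finite_funs[OF assms])
  show "{x. valid V x \<and> card (packets x) \<le> n}
      \<subseteq> {x. \<forall>a. (a \<in> V \<longrightarrow> x a \<in> ?B) \<and> (a \<notin> V \<longrightarrow> x a = (\<lambda>_. {}))}"
  proof (rule subsetI)
    fix x assume "x \<in> {x. valid V x \<and> card (packets x) \<le> n}"
    then have x: "valid V x" "card (packets x) \<le> n" by auto
    then have "packets x \<subseteq> {1..n}"
      by (subst packets_eq[OF x(1)]) auto
    then have "x a b \<subseteq> {1..n}" for a b
      unfolding packets_def by blast
    moreover have "x a b = {}" if "a \<notin> V \<or> b \<notin> V" for a b
      using x(1) that unfolding valid_def by blast
    ultimately show "x \<in> {x. \<forall>a. (a \<in> V \<longrightarrow> x a \<in> ?B) \<and> (a \<notin> V \<longrightarrow> x a = (\<lambda>_. {}))}"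
      by (auto simp: fun_eq_iff)
  qed
qed

text \<open>A present packet is missing at some \<open>v\<close> and hence confined to
  \<open>V - {v}\<close>. So bounded occupancies leave only boundedly many packets.\<close>

lemma card_packets_le:
  assumes "finite V" and x: "valid V x"
  shows "card (packets x) \<le> (\<Sum>v\<in>V. card (confined V x (V - {v})))"
proof -
  have "packets x \<subseteq> (\<Union>v\<in>V. confined V x (V - {v}))"
    using packets_iff[OF x] holders_subset[of V x] by (fastforce simp: confined_def)
  then have "card (packets x) \<le> card (\<Union>v\<in>V. confined V x (V - {v}))"
    using assms finite_confined[OF x] by (intro card_mono) auto
  also have "\<dots> \<le> (\<Sum>v\<in>V. card (confined V x (V - {v})))"
    by (rule card_UN_le[OF assms(1)])
  finally show ?thesis .
qed

text \<open>A packet confined to \<open>S\<close> is missing at \<open>v\<close>: it is useful on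
  (u, v) if \<open>u\<close> holds it, and confined to \<open>S - {u}\<close> otherwise. Useful
  packets and those confined to \<open>S\<close> all lie in \<open>confined V x (V - {v})\<close>,
  and inclusion-exclusion gives the second part.\<close>

lemma card_confined_split:
  assumes x: "valid V x" and "u \<in> S" "v \<notin> S" "S \<subset> V" "v \<in> V"
  shows "card (confined V x S) = card (useful x (u, v) \<inter> confined V x S) + card (confined V x (S - {u}))"
    and "card (useful x (u, v)) + card (confined V x S)
      \<le> card (confined V x (V - {v})) + card (useful x (u, v) \<inter> confined V x S)"
proof -
  have U: "useful x (u, v) = {j \<in> packets x. u \<in> holders V x j \<and> v \<notin> holders V x j}"
    using assms by (intro useful_eq) auto
  have "confined V x S = (useful x (u, v) \<inter> confined V x S) \<union> confined V x (S - {u})"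
    using assms unfolding U by (auto simp: confined_def)
  moreover have "(useful x (u, v) \<inter> confined V x S) \<inter> confined V x (S - {u}) = {}"
    unfolding U by (auto simp: confined_def)
  ultimately show "card (confined V x S) = card (useful x (u, v) \<inter> confined V x S) + card (confined V x (S - {u}))"
    using finite_confined[OF x] by (metis card_Un_disjoint finite_Int)
  have "useful x (u, v) \<union> confined V x S \<subseteq> confined V x (V - {v})"
    using assms holders_subset[of V x] unfolding U by (fastforce simp: confined_def)
  then have "card (useful x (u, v) \<union> confined V x S) \<le> card (confined V x (V - {v}))"
    using finite_confined[OF x] by (intro card_mono) auto
  then show "card (useful x (u, v)) + card (confined V x S)
      \<le> card (confined V x (V - {v})) + card (useful x (u, v) \<inter> confined V x S)"
    using card_Un_Int[OF finite_useful[OF x, of "(u, v)"] finite_confined[OF x, of S]] by simp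
qed

text \<open>A packet sent by \<open>u\<close> is held at \<open>u\<close>; so it is confined to
  \<open>S\<close> only if \<open>u\<close> is in \<open>S\<close>, and it stays confined if
  \<open>v\<close> is in \<open>S\<close>. Only links across the cut can lower the occupancy, by one
  packet at a time.\<close>

lemma card_confined_delivered:
  assumes x: "valid V x" and uv: "u \<in> V" "v \<in> V" and S: "S \<subset> V"
    and r: "r \<in> insert None (Some ` available x u)"
  shows "card (confined V (delivered x v r) S) \<le> card (confined V x S)"
    and "card (confined V x S) \<le> card (confined V (delivered x v r) S) + of_bool (u \<in> S \<and> v \<notin> S)"
proof -
  show "card (confined V (delivered x v r) S) \<le> card (confined V x S)"
    using card_confined_transmit[OF x uv(2) S] finite_confined[OF x, of S] by (cases r) (auto intro: card_mono)
  show "card (confined V x S) \<le> card (confined V (delivered x v r) S) + of_bool (u \<in> S \<and> v \<notin> S)"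
  proof (cases r)
    case (Some j)
    then have j: "u \<in> holders V x j"
      using r available_eq[OF uv(1), of x] by auto
    show ?thesis
    proof (cases "u \<in> S \<and> v \<notin> S")
      case True
      have "0 < card (confined V x S)" if "j \<in> confined V x S"
        using that finite_confined[OF x, of S] by (auto simp: card_gt_0_iff)
      then show ?thesis
        using True Some card_confined_transmit[OF x uv(2) S, of j]
        by (auto simp: card_Diff_singleton_if)
    next
      case False
      then have "confined V x S - (if v \<in> S then {} else {j}) = confined V x S"
        using j by (auto simp: confined_def)
      then show ?thesis
        using Some card_confined_transmit[OF x uv(2) S, of j] by simp
    qed
  qed simp
qed

lemma reachable_step:
  fixes q :: "'s \<Rightarrow> 's \<Rightarrow> real"
  shows "x \<in> reachable q z \<Longrightarrow> 0 < q x y \<Longrightarrow> y \<in> reachable q z"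
  unfolding reachable_def by (auto intro: rtranclp.rtrancl_into_rtrancl)

lemma confined_empty_config: "confined V empty_config S = {}"
  by (auto simp: confined_def empty_config_def packets_def)

context broadcast_network
begin

lemma valid_step:
  assumes d: "admissible_on_valid V E d" and x: "valid V x"
    and "0 < network_rate V E c lam d x y"
  shows "valid V y"
  using assms(3)
proof (cases rule: network_rate_pos_cases)
  case (arrive u)
  then show ?thesis using valid_arrive[OF x] by simp
next
  case (deliver u v r)
  have r: "r \<in> insert None (Some ` available x u)"
    using d x deliver(1,2) unfolding admissible_on_valid_def by blast
  have v: "v \<in> V" using E deliver(1) by auto
  show ?thesis
    using r x deliver(3) valid_transmit[OF x v] by (auto simp: available_def)
qed

lemma valid_reachable:
  assumes d: "admissible_on_valid V E d"
    and "x \<in> reachable (network_rate V E c lam d) empty_config"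
  shows "valid V x"
proof -
  have "(\<lambda>a b. 0 < network_rate V E c lam d a b)\<^sup>*\<^sup>* empty_config x"
    using assms(2) by (simp add: reachable_def)
  then show ?thesis
    by induction (auto simp: valid_empty_config intro: valid_step[OF d])
qed

lemma not_stable:
  assumes d: "admissible_on_valid V E d" and S: "S \<subset> V" and u0: "u\<^sub>0 \<in> S" "0 < lam u\<^sub>0"
    and cut: "(\<Sum>e\<in>{(u, v)\<in>E. u \<in> S \<and> v \<notin> S}. c e) \<le> (\<Sum>u\<in>S. lam u)"
  shows "\<not> stable V E c lam d"
proof -
  let ?q = "network_rate V E c lam d"
  let ?X = "reachable ?q empty_config"
  let ?N = "\<lambda>x. card (confined V x S)"
  let ?R = "(\<Sum>u\<in>V. lam u) + (\<Sum>e\<in>E. c e)"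
  have valid: "valid V x" if "x \<in> ?X" for x
    using valid_reachable[OF d that] .
  have empty: "empty_config \<in> ?X"
    by (simp add: reachable_def)
  have u0V: "u\<^sub>0 \<in> V" using S u0 by auto
  have N_arrive: "?N (arrive V x u) = ?N x + of_bool (u \<in> S)" if "x \<in> ?X" "u \<in> V" for x u
    using card_confined_arrive[OF valid[OF that(1)] that(2) S] .
  have adm: "r \<in> insert None (Some ` available x u)" if "x \<in> ?X" "(u, v) \<in> E" "r \<in> set_pmf (d x (u, v))" for x u v r
    using d valid[OF that(1)] that(2,3) unfolding admissible_on_valid_def by blast
  have N_deliver: "?N (delivered x v r) \<le> ?N x" "?N x \<le> ?N (delivered x v r) + of_bool (u \<in> S \<and> v \<notin> S)"
    if "x \<in> ?X" "(u, v) \<in> E" "r \<in> set_pmf (d x (u, v))" for x u v r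
    using card_confined_delivered[OF valid[OF that(1)] _ _ S adm[OF that], of v] E that(2) by auto
  have "\<not> positive_recurrent ?q empty_config"
  proof (rule not_positive_recurrent_of_drift[where X="?X" and N="?N" and R="?R"])
    show "0 \<le> ?q z y" for z y
      by (rule network_rate_nonneg)
    show "y \<in> ?X" if "z \<in> ?X" "0 < ?q z y" for z y
      by (rule reachable_step[where q="?q", OF that])
    show "rate_sum ?q (\<lambda>_. 1) z = ennreal ?R" for z
      by (rule rate_sum_network_1)
    show "empty_config \<in> ?X"
      by (rule empty)
    show "?N empty_config = 0"
      by (simp add: confined_empty_config)
    \<comment> \<open>As \<open>S\<close> is a strict subset, the new packet is missing somewhere,
      stays in the network and is counted by \<open>?N\<close>.\<close>
    have "arrive V empty_config u\<^sub>0 \<noteq> empty_config"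
      using N_arrive[OF empty u0V] u0 by (auto simp: confined_empty_config)
    then have "?q empty_config (arrive V empty_config u\<^sub>0) \<le> exit_rate ?q empty_config"
      by (intro le_exit_rate network_rate_nonneg)
        (simp_all add: rate_sum_network_1)
    then show "exit_rate ?q empty_config \<noteq> 0"
      using network_rate_arrive[OF u0V, of d empty_config] u0 by simp
    show "?N y \<le> Suc (?N z)" if z: "z \<in> ?X" and "0 < ?q z y" for z y
      using that(2)
    proof (cases rule: network_rate_pos_cases)
      case (arrive u)
      then show ?thesis using N_arrive[OF z] by simp
    next
      case (deliver u v r)
      then show ?thesis using N_deliver(1)[OF z deliver(1,2)] by simp
    qed
    show "ennreal ?R * of_nat (?N z) \<le> rate_sum ?q (\<lambda>y. of_nat (?N y)) z" if z: "z \<in> ?X" for z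
    proof -
      let ?I = "\<lambda>e. \<integral>\<^sup>+r. of_nat (?N (delivered z (snd e) r)) \<partial>d z e"
      let ?cut = "{(u, v)\<in>E. u \<in> S \<and> v \<notin> S}"
      let ?C = "\<Sum>e\<in>?cut. c e" and ?L = "\<Sum>u\<in>S. lam u"
      have I: "of_nat (?N z) \<le> ?I e + of_bool (e \<in> ?cut)" if e: "e \<in> E" for e
      proof -
        have "(\<integral>\<^sup>+r. of_nat (?N z) \<partial>d z e) \<le> (\<integral>\<^sup>+r. of_nat (?N (delivered z (snd e) r)) + of_bool (e \<in> ?cut) \<partial>d z e)"
        proof (intro nn_integral_mono_AE, unfold AE_measure_pmf_iff, intro ballI)
          fix r assume "r \<in> set_pmf (d z e)"
          then have "?N z \<le> ?N (delivered z (snd e) r) + of_bool (e \<in> ?cut)"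
            using N_deliver(2)[OF z, of "fst e" "snd e" r] e by (simp add: case_prod_beta)
          then have "(of_nat (?N z) :: ennreal) \<le> of_nat (?N (delivered z (snd e) r) + of_bool (e \<in> ?cut))"
            by (rule of_nat_mono)
          then show "(of_nat (?N z) :: ennreal) \<le> of_nat (?N (delivered z (snd e) r)) + of_bool (e \<in> ?cut)"
            by simp
        qed
        then show ?thesis by (simp add: nn_integral_add)
      qed
      have finE: "finite E" by (rule finite_links)
      have C: "(\<Sum>e\<in>E. ennreal (c e) * of_bool (e \<in> ?cut)) = ennreal ?C"
      proof -
        have "(\<Sum>e\<in>E. ennreal (c e) * of_bool (e \<in> ?cut)) = (\<Sum>e\<in>?cut. ennreal (c e))"
          using finE by (intro sum.mono_neutral_cong_right) auto
        then show ?thesis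
          using c_pos by (subst (asm) sum_ennreal) (auto intro: less_imp_le)
      qed
      have L: "(\<Sum>u\<in>V. ennreal (lam u) * of_nat (of_bool (u \<in> S))) = ennreal ?L"
      proof -
        have "(\<Sum>u\<in>V. ennreal (lam u) * of_nat (of_bool (u \<in> S))) = (\<Sum>u\<in>S. ennreal (lam u))"
          using finV S by (intro sum.mono_neutral_cong_right) auto
        then show ?thesis
          using lam_nonneg S by (subst (asm) sum_ennreal) auto
      qed
      have R: "ennreal ?R = (\<Sum>u\<in>V. ennreal (lam u)) + (\<Sum>e\<in>E. ennreal (c e))"
        using rate_sum_network_1[of d z] unfolding rate_sum_network by simp
      \<comment> \<open>To avoid subtraction in \<open>ennreal\<close>, the capacity of the cut is
        carried on both sides and cancelled at the end.\<close>
      have "ennreal ?R * of_nat (?N z) + ennreal ?C \<le> ennreal ?R * of_nat (?N z) + ennreal ?L"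
        using cut by (intro add_left_mono ennreal_leI)
      also have "\<dots> = (\<Sum>u\<in>V. ennreal (lam u) * of_nat (?N (arrive V z u))) + (\<Sum>e\<in>E. ennreal (c e) * of_nat (?N z))"
      proof -
        have "(\<Sum>u\<in>V. ennreal (lam u) * of_nat (?N (arrive V z u)))
            = (\<Sum>u\<in>V. ennreal (lam u) * of_nat (?N z) + ennreal (lam u) * of_nat (of_bool (u \<in> S)))"
          by (intro sum.cong refl) (simp only: N_arrive[OF z] of_nat_add distrib_left)
        then show ?thesis
          unfolding R distrib_right sum_distrib_right by (simp only: sum.distrib L ac_simps)
      qed
      also have "\<dots> \<le> (\<Sum>u\<in>V. ennreal (lam u) * of_nat (?N (arrive V z u)))
          + (\<Sum>e\<in>E. ennreal (c e) * (?I e + of_bool (e \<in> ?cut)))"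
        by (intro add_left_mono sum_mono mult_left_mono I) auto
      also have "\<dots> = rate_sum ?q (\<lambda>y. of_nat (?N y)) z + ennreal ?C"
        unfolding rate_sum_network by (simp only: distrib_left sum.distrib C add_ac)
      finally show ?thesis
        unfolding add.commute[of _ "ennreal ?C"] ennreal_add_left_cancel_le by simp
    qed
    have "0 < ennreal (lam u\<^sub>0) * of_nat (?N (arrive V empty_config u\<^sub>0))"
      using u0 N_arrive[OF empty u0V] by (simp add: ennreal_zero_less_mult_iff confined_empty_config)
    also have "\<dots> \<le> (\<Sum>u\<in>V. ennreal (lam u) * of_nat (?N (arrive V empty_config u)))"
      by (rule member_le_sum[OF u0V]) (use finV in auto)
    also have "\<dots> \<le> rate_sum ?q (\<lambda>y. of_nat (?N y)) empty_config"
      unfolding rate_sum_network by simp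
    finally show "0 < rate_sum ?q (\<lambda>y. of_nat (?N y)) empty_config" .
  qed
  then show ?thesis
    using empty unfolding stable_def by blast
qed

text \<open>The holders of a present packet form a nonempty strict subset, and the cut condition
  forces a link (u, v) to leave it, on which this packet is chosen with positive probability.
  Sending it raises no occupancy and lowers that of \<open>V - {v}\<close>, so the sum of all
  occupancies is a termination measure.\<close>

lemma reaches_empty_config:
  assumes cut: "cut_condition V E c lam" and x: "valid V x"
  shows "(\<lambda>a b. 0 < network_rate V E c lam random_useful a b)\<^sup>*\<^sup>* x empty_config"
  using x
proof (induction "\<Sum>S\<in>{S. S \<subset> V}. card (confined V x S)" arbitrary: x rule: less_induct)
  case (less x)
  show ?case
  proof (cases "packets x = {}")
    case True
    then show ?thesis by (simp add: packets_empty_iff)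
  next
    case False
    then obtain j where j: "j \<in> packets x" by auto
    let ?H = "holders V x j"
    have H: "?H \<noteq> {}" "?H \<subset> V"
      using j less.prems packets_iff[OF less.prems, of j] holders_subset[of V x j] by (auto simp: valid_def)
    have "0 \<le> (\<Sum>u\<in>?H. lam u)"
      using holders_subset[of V x j] lam_nonneg by (intro sum_nonneg) auto
    also have "\<dots> < (\<Sum>e\<in>{(u, v)\<in>E. u \<in> ?H \<and> v \<notin> ?H}. c e)"
      using cut H unfolding cut_condition_def by blast
    finally have "{(u, v)\<in>E. u \<in> ?H \<and> v \<notin> ?H} \<noteq> {}"
      by (metis less_irrefl sum.empty)
    then obtain u v where uv: "(u, v) \<in> E" "u \<in> ?H" "v \<notin> ?H" by auto
    then have V: "u \<in> V" "v \<in> V" using E by auto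
    have ju: "j \<in> useful x (u, v)"
      using uv j by (simp add: useful_eq[OF V])
    have "Some j \<in> set_pmf (random_useful x (u, v))"
      using ju by (auto simp: set_random_useful[OF less.prems])
    from network_rate_deliver[where d=random_useful, OF uv(1) this]
    have pos: "0 < network_rate V E c lam random_useful x (transmit x v j)" by simp
    have "(\<Sum>S\<in>{S. S \<subset> V}. card (confined V (transmit x v j) S)) < (\<Sum>S\<in>{S. S \<subset> V}. card (confined V x S))"
    proof (rule sum_strict_mono_ex1)
      show "finite {S. S \<subset> V}"
        by (rule finite_subset[of _ "Pow V"]) (use finV in auto)
      show "\<forall>S\<in>{S. S \<subset> V}. card (confined V (transmit x v j) S) \<le> card (confined V x S)"
        using card_confined_transmit[OF less.prems V(2)] finite_confined[OF less.prems] by (auto intro: card_mono)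
      have "j \<in> confined V x (V - {v})"
        using j uv holders_subset[of V x j] by (auto simp: confined_def)
      moreover have "V - {v} \<subset> V"
        using V by auto
      ultimately have "card (confined V (transmit x v j) (V - {v})) < card (confined V x (V - {v}))"
        using card_confined_transmit[OF less.prems V(2), of "V - {v}" j]
          card_Diff1_less[OF finite_confined[OF less.prems], of j "V - {v}"] by simp
      then show "\<exists>S\<in>{S. S \<subset> V}. card (confined V (transmit x v j) S) < card (confined V x S)"
        using V by (intro bexI[of _ "V - {v}"]) auto
    qed
    then have rest: "(\<lambda>a b. 0 < network_rate V E c lam random_useful a b)\<^sup>*\<^sup>* (transmit x v j) empty_config"
      using less.hyps valid_transmit[OF less.prems V(2) j] by blast
    show ?thesis
      by (rule converse_rtranclp_into_rtranclp[OF _ rest]) (rule pos)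
  qed
qed

end

text \<open>For a link leaving \<open>S\<close>, the probability that an epoch releases a packet
  from confinement to \<open>S\<close>. If nothing is useful, division by zero gives 0, in
  accordance with no transmission.\<close>

definition useful_share :: "'v set \<Rightarrow> 'v config \<Rightarrow> 'v set \<Rightarrow> 'v \<times> 'v \<Rightarrow> real" where
  "useful_share V x S e = card (useful x e \<inter> confined V x S) / card (useful x e)"

lemma useful_share_bounds:
  assumes "valid V x"
  shows "0 \<le> useful_share V x S e" "useful_share V x S e \<le> 1"
proof -
  have "card (useful x e \<inter> confined V x S) \<le> card (useful x e)"
    by (intro card_mono finite_useful[OF assms]) auto
  then show "useful_share V x S e \<le> 1"
    by (simp add: useful_share_def divide_le_eq)
qed (simp add: useful_share_def)

text \<open>Across the cut, the occupancy drops by 1 with probability \<open>useful_share\<close>,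
  which multiplies the exponential by \<open>exp (- t)\<close>; on other links it is
  constant.\<close>

lemma nn_integral_random_useful_exp:
  fixes t :: real
  assumes x: "valid V x" and uv: "u \<in> V" "v \<in> V" and S: "S \<subset> V" and t: "0 \<le> t"
  shows "(\<integral>\<^sup>+r. ennreal (exp (t * card (confined V (delivered x v r) S))) \<partial>random_useful x (u, v))
    = ennreal (exp (t * card (confined V x S)) *
        (1 - (if u \<in> S \<and> v \<notin> S then useful_share V x S (u, v) else 0) * (1 - exp (- t))))"
proof (cases "u \<in> S \<and> v \<notin> S \<and> useful x (u, v) \<noteq> {}")
  case True
  let ?U = "useful x (u, v)" and ?C = "confined V x S"
  have finU: "finite ?U" by (rule finite_useful[OF x])
  have step: "exp (t * card (confined V (transmit x v j) S)) = exp (t * card ?C) * (if j \<in> ?C then exp (- t) else 1)" for j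
  proof (cases "j \<in> ?C")
    case True
    then have "0 < card ?C"
      using finite_confined[OF x, of S] by (auto simp: card_gt_0_iff)
    then have eq: "card (confined V (transmit x v j) S) = real (card ?C) - 1"
      using True card_confined_transmit[OF x uv(2) S, of j] \<open>u \<in> S \<and> v \<notin> S \<and> _\<close> by simp
    show ?thesis
      unfolding eq using True by (simp add: exp_add[symmetric] right_diff_distrib)
  next
    case False
    then show ?thesis
      using card_confined_transmit[OF x uv(2) S, of j] by simp
  qed
  have "(\<integral>\<^sup>+r. ennreal (exp (t * card (confined V (delivered x v r) S))) \<partial>random_useful x (u, v))
      = (\<Sum>j\<in>?U. ennreal (exp (t * card ?C) * (if j \<in> ?C then exp (- t) else 1))) / card ?U"
    using True finU by (simp add: random_useful_def nn_integral_pmf_of_set step)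
  also have "\<dots> = ennreal ((\<Sum>j\<in>?U. exp (t * card ?C) * (if j \<in> ?C then exp (- t) else 1)) / card ?U)"
  proof -
    have "0 \<le> (\<Sum>j\<in>?U. exp (t * card ?C) * (if j \<in> ?C then exp (- t) else 1))"
      by (intro sum_nonneg) auto
    moreover have "0 < real (card ?U)"
      using True finU by (simp add: card_gt_0_iff)
    ultimately show ?thesis
      by (subst sum_ennreal) (auto simp: ennreal_of_nat_eq_real_of_nat divide_ennreal)
  qed
  also have "(\<Sum>j\<in>?U. exp (t * card ?C) * (if j \<in> ?C then exp (- t) else 1))
      = exp (t * card ?C) * (card ?U - card (?U \<inter> ?C) * (1 - exp (- t)))"
  proof -
    have "(\<Sum>j\<in>?U. if j \<in> ?C then exp (- t) else 1) = (\<Sum>j\<in>?U. 1 - (if j \<in> ?C then 1 - exp (- t) else 0))"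
      by (intro sum.cong) auto
    also have "\<dots> = card ?U - card (?U \<inter> ?C) * (1 - exp (- t))"
      using finU by (simp add: sum_subtractf sum.If_cases)
    finally show ?thesis
      by (simp only: sum_distrib_left[symmetric])
  qed
  also have "\<dots> / card ?U = exp (t * card ?C) * (1 - useful_share V x S (u, v) * (1 - exp (- t)))"
    using True finU by (simp add: useful_share_def field_simps card_gt_0_iff)
  finally show ?thesis using True by simp
next
  case False
  have "card (confined V (delivered x v r) S) = card (confined V x S)" if "r \<in> set_pmf (random_useful x (u, v))" for r
  proof (cases "useful x (u, v) = {}")
    case True
    then show ?thesis using that by (simp add: set_random_useful[OF x])
  next
    case False
    then have "r \<in> insert None (Some ` available x u)"
      using that by (auto simp: set_random_useful[OF x] useful_def)
    from card_confined_delivered[OF x uv S this] show ?thesis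
      using False \<open>\<not> (u \<in> S \<and> v \<notin> S \<and> _)\<close> by auto
  qed
  then have "(\<integral>\<^sup>+r. ennreal (exp (t * card (confined V (delivered x v r) S))) \<partial>random_useful x (u, v))
      = (\<integral>\<^sup>+r. ennreal (exp (t * card (confined V x S))) \<partial>random_useful x (u, v))"
    by (intro nn_integral_cong_AE) (simp add: AE_measure_pmf_iff)
  then show ?thesis
    using False by (auto simp: useful_share_def)
qed

section \<open>The Lyapunov function\<close>

text \<open>
  A packet useful on \<open>(u, v)\<close> is confined to \<open>V - {v}\<close>. So if the share of \<open>S\<close> on a link \<open>(u, v)\<close>
  leaving \<open>S\<close> is small, then the packets confined to \<open>V - {v}\<close> clearly outnumber those confined
  to \<open>S\<close>, unless almost all of the latter are already confined to \<open>S - {u}\<close>. The geometric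
  weights make one of these two sets win in either case.
\<close>

lemma larger_weighted_occupancy:
  fixes V :: "'v set" and \<rho> \<kappa> :: real
  defines "\<beta> \<equiv> \<lambda>S :: 'v set. 1 + (\<rho> / 6) ^ card S"
  assumes finV: "finite V" and x: "valid V x" and rho: "0 < \<rho>" "\<rho> \<le> 1"
    and kappa: "0 \<le> \<kappa>" "2 * \<kappa> \<le> (\<rho> / 6) ^ card V"
    and S: "S \<subset> V" and uv: "u \<in> S" "v \<in> V" "v \<notin> S"
    and share: "useful_share V x S (u, v) < 1 - \<rho>"
  shows "\<exists>T. T \<noteq> {} \<and> T \<subset> V \<and>
    (1 + \<kappa>) * (\<beta> S * card (confined V x S)) \<le> \<beta> T * card (confined V x T)"
proof -
  define b where "b = (\<rho> / 6) ^ card S"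
  define M where "M = real (card (confined V x S))"
  define M1 where "M1 = real (card (confined V x (S - {u})))"
  define M2 where "M2 = real (card (confined V x (V - {v})))"
  define a where "a = real (card (useful x (u, v) \<inter> confined V x S))"
  define d where "d = real (card (useful x (u, v)))"
  have a: "M = a + M1" and d: "d + M \<le> M2 + a"
    using card_confined_split[OF x uv(1,3) S uv(2)] unfolding M_def M1_def M2_def a_def d_def by linarith+
  have nonneg: "0 \<le> a" "0 \<le> M" "0 \<le> M1" "0 \<le> M2" "0 \<le> d" "a \<le> d"
    using finite_useful[OF x] by (auto simp: a_def M_def M1_def M2_def d_def intro: card_mono)
  \<comment> \<open>The \<open>d - a\<close> useful packets not confined to \<open>S\<close> are
    what \<open>V - {v}\<close> has in addition to \<open>S\<close>. For \<open>d = 0\<close> the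
    share is a default value, but then \<open>a = 0\<close> too.\<close>
  have share': "\<rho> * a \<le> d - a"
  proof (cases "d = 0")
    case False
    then have "a < (1 - \<rho>) * d"
      using share nonneg unfolding useful_share_def a_def[symmetric] d_def[symmetric]
      by (simp add: pos_divide_less_eq)
    moreover have "\<rho> * a \<le> \<rho> * d"
      using nonneg rho by (intro mult_left_mono) auto
    ultimately show ?thesis by (simp add: algebra_simps)
  qed (use nonneg in simp)
  have finS: "finite S" using finV S finite_subset by blast
  have cS: "0 < card S" "card S \<le> card V"
    using uv finS S finV by (auto simp: card_gt_0_iff intro: card_mono)
  have b: "0 < b" "b \<le> 1" "2 * \<kappa> \<le> b"
  proof -
    show "0 < b" "b \<le> 1"
      unfolding b_def using rho by (auto intro!: power_le_one)
    have "(\<rho> / 6) ^ card V \<le> b"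
      unfolding b_def using cS rho by (intro power_decreasing) auto
    then show "2 * \<kappa> \<le> b" using kappa by simp
  qed
  \<comment> \<open>The factor \<open>1 + 2 * b\<close> is the common target for both candidate
    sets; it exceeds the weight \<open>1 + b\<close> of \<open>S\<close> by at least the factor
    \<open>1 + \<kappa>\<close>.\<close>
  have kb: "(1 + \<kappa>) * (1 + b) \<le> 1 + 2 * b"
  proof -
    have "\<kappa> * (1 + b) \<le> b / 2 * (1 + 1)"
      using b kappa by (intro mult_mono) auto
    then show ?thesis by (simp add: algebra_simps)
  qed
  have le_target: "(1 + \<kappa>) * (\<beta> S * card (confined V x S)) \<le> w" if "(1 + 2 * b) * M \<le> w" for w
  proof -
    have "(1 + \<kappa>) * (1 + b) * M \<le> (1 + 2 * b) * M"
      by (intro mult_right_mono kb nonneg)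
    with that show ?thesis
      unfolding \<beta>_def M_def b_def by (simp add: mult.assoc)
  qed
  show ?thesis
  proof (cases "M = 0")
    case True
    then show ?thesis
      using S uv by (intro exI[of _ S]) (auto simp: M_def)
  next
    case False
    then have M: "0 < M" using nonneg by simp
    define b' where "b' = 6 * b / \<rho>"
    have b': "(\<rho> / 6) ^ card (S - {u}) = b'"
    proof -
      have "card S = Suc (card (S - {u}))"
        by (rule card.remove[OF finS uv(1)])
      then have "b = \<rho> / 6 * (\<rho> / 6) ^ card (S - {u})"
        unfolding b_def by (simp only: power_Suc)
      then show ?thesis
        unfolding b'_def using rho by (simp add: eq_divide_eq mult.commute)
    qed
    have b'_le: "0 < b'" "b' \<le> 1"
      unfolding b'[symmetric] using rho by (auto intro!: power_le_one)
    \<comment> \<open>The threshold balances the two candidates. If at most a fraction b'/3 is lost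
      in \<open>S - {u}\<close>, its weight wins: (1 + b') (1 - b'/3) \<ge> 1 + b'/3 \<ge> 1 + 2 b.
      Otherwise more than M b'/3 confined packets are useful on the link, and \<open>V - {v}\<close>
      has a surplus of at least \<rho> M b'/3 = 2 b M. This last equation is the origin of the 6 in
      the weights.\<close>
    show ?thesis
    proof (cases "M1 \<ge> M * (1 - b' / 3)")
      case True
      have "S - {u} \<noteq> {}"
      proof
        assume eq: "S - {u} = {}"
        have "confined V x (S - {u}) = {}"
          unfolding eq using x by (auto simp: confined_def valid_def)
        then have "M1 = 0" by (simp add: M1_def)
        moreover have "0 < M * (1 - b' / 3)"
          using M b'_le by (intro mult_pos_pos) auto
        ultimately show False using True by simp
      qed
      moreover have "S - {u} \<subset> V" using S by auto
      moreover have "(1 + 2 * b) * M \<le> \<beta> (S - {u}) * card (confined V x (S - {u}))"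
      proof -
        have "2 * b = \<rho> * b' / 3"
          using rho by (simp add: b'_def)
        also have "\<dots> \<le> 1 * b' / 3"
          using rho b'_le by (intro divide_right_mono mult_right_mono) auto
        also have "\<dots> \<le> (1 + b') * (1 - b' / 3) - 1"
        proof -
          have "b' * b' \<le> b' * 1" using b'_le by (intro mult_left_mono) auto
          then show ?thesis by (simp add: field_simps)
        qed
        finally have "(1 + 2 * b) * M \<le> (1 + b') * (1 - b' / 3) * M"
          using M by (intro mult_right_mono) auto
        also have "\<dots> = (1 + b') * (M * (1 - b' / 3))"
          by (simp only: ac_simps)
        also have "\<dots> \<le> (1 + b') * M1"
          using True b'_le by (intro mult_left_mono) auto
        finally show ?thesis
          by (simp add: \<beta>_def b' M1_def)
      qed
      ultimately show ?thesis
        by (intro exI[of _ "S - {u}"] conjI le_target)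
    next
      case False
      have "2 * b * M = \<rho> * (M * (b' / 3))"
        using rho by (simp add: b'_def)
      also have "\<dots> \<le> \<rho> * (M - M1)"
        using False rho by (intro mult_left_mono) (auto simp: algebra_simps)
      also have "\<dots> \<le> M2 - M"
        using share' a d by simp
      finally have "(1 + 2 * b) * M \<le> 1 * M2"
        by (simp add: algebra_simps)
      also have "\<dots> \<le> \<beta> (V - {v}) * M2"
        using nonneg rho by (intro mult_right_mono) (auto simp: \<beta>_def)
      finally have "(1 + 2 * b) * M \<le> \<beta> (V - {v}) * card (confined V x (V - {v}))"
        by (simp add: M2_def)
      moreover have "V - {v} \<noteq> {}" "V - {v} \<subset> V"
        using uv S by auto
      ultimately show ?thesis
        by (intro exI[of _ "V - {v}"] conjI le_target)
    qed
  qed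
qed

section \<open>Drift of exponentials of occupancies, and sufficiency of the cut condition\<close>

context broadcast_network
begin

lemma rate_sum_exp:
  fixes t :: real
  assumes x: "valid V x" and S: "S \<subset> V" and t: "0 \<le> t"
  shows "rate_sum (network_rate V E c lam random_useful) (\<lambda>y. ennreal (exp (t * card (confined V y S)))) x
    = ennreal (exp (t * card (confined V x S)) *
        ((\<Sum>u\<in>V. lam u) + (\<Sum>e\<in>E. c e) + (\<Sum>u\<in>S. lam u) * (exp t - 1)
          - (\<Sum>e\<in>{(u, v)\<in>E. u \<in> S \<and> v \<notin> S}. c e * useful_share V x S e) * (1 - exp (- t))))"
proof -
  let ?cut = "{(u, v)\<in>E. u \<in> S \<and> v \<notin> S}"
  let ?f = "exp (t * card (confined V x S))"
  let ?p = "\<lambda>e. if e \<in> ?cut then useful_share V x S e else 0"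
  have A: "exp (t * card (confined V (arrive V x u) S)) = ?f * (1 + of_bool (u \<in> S) * (exp t - 1))" if "u \<in> V" for u
    using card_confined_arrive[OF x that S] by (simp add: exp_add algebra_simps)
  have D: "(\<integral>\<^sup>+r. ennreal (exp (t * card (confined V (delivered x (snd e) r) S))) \<partial>random_useful x e)
      = ennreal (?f * (1 - ?p e * (1 - exp (- t))))" if "e \<in> E" for e
    using nn_integral_random_useful_exp[OF x _ _ S t, of "fst e" "snd e"] E that
    by (auto simp: case_prod_beta)
  have nonneg_A: "0 \<le> 1 + of_bool (u \<in> S) * (exp t - 1)" for u
    using t by simp
  have nonneg_D: "0 \<le> 1 - ?p e * (1 - exp (- t))" for e
  proof -
    have "?p e * (1 - exp (- t)) \<le> 1 * 1"
      using useful_share_bounds[OF x] t by (intro mult_mono) auto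
    then show ?thesis by simp
  qed
  have "rate_sum (network_rate V E c lam random_useful) (\<lambda>y. ennreal (exp (t * card (confined V y S)))) x
    = (\<Sum>u\<in>V. ennreal (lam u * (?f * (1 + of_bool (u \<in> S) * (exp t - 1)))))
      + (\<Sum>e\<in>E. ennreal (c e * (?f * (1 - ?p e * (1 - exp (- t))))))"
    unfolding rate_sum_network
    by (intro arg_cong2[where f="(+)"] sum.cong refl)
      (simp_all add: A D ennreal_mult' lam_nonneg less_imp_le[OF c_pos])
  also have "\<dots> = ennreal ((\<Sum>u\<in>V. lam u * (?f * (1 + of_bool (u \<in> S) * (exp t - 1))))
      + (\<Sum>e\<in>E. c e * (?f * (1 - ?p e * (1 - exp (- t))))))"
  proof -
    have "0 \<le> lam u * (?f * (1 + of_bool (u \<in> S) * (exp t - 1)))" if "u \<in> V" for u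
      using lam_nonneg[OF that] nonneg_A by (intro mult_nonneg_nonneg) auto
    moreover have "0 \<le> c e * (?f * (1 - ?p e * (1 - exp (- t))))" if "e \<in> E" for e
      using less_imp_le[OF c_pos[OF that]] nonneg_D by (intro mult_nonneg_nonneg) auto
    ultimately show ?thesis
      by (subst (1 2) sum_ennreal) (auto intro!: ennreal_plus[symmetric] sum_nonneg)
  qed
  also have "(\<Sum>u\<in>V. lam u * (?f * (1 + of_bool (u \<in> S) * (exp t - 1))))
      = ?f * ((\<Sum>u\<in>V. lam u) + (\<Sum>u\<in>S. lam u) * (exp t - 1))"
  proof -
    have "(\<Sum>u\<in>V. lam u * of_bool (u \<in> S)) = (\<Sum>u\<in>S. lam u)"
      using finV S by (intro sum.mono_neutral_cong_right) auto
    then have "?f * ((\<Sum>u\<in>V. lam u) + (\<Sum>u\<in>S. lam u) * (exp t - 1))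
        = ?f * ((\<Sum>u\<in>V. lam u) + (\<Sum>u\<in>V. lam u * of_bool (u \<in> S)) * (exp t - 1))"
      by simp
    also have "\<dots> = (\<Sum>u\<in>V. lam u * (?f * (1 + of_bool (u \<in> S) * (exp t - 1))))"
      by (simp only: sum_distrib_right sum_distrib_left sum.distrib[symmetric]) (simp add: algebra_simps)
    finally show ?thesis by simp
  qed
  also have "(\<Sum>e\<in>E. c e * (?f * (1 - ?p e * (1 - exp (- t)))))
      = ?f * ((\<Sum>e\<in>E. c e) - (\<Sum>e\<in>?cut. c e * useful_share V x S e) * (1 - exp (- t)))"
  proof -
    have "(\<Sum>e\<in>E. c e * ?p e) = (\<Sum>e\<in>?cut. c e * useful_share V x S e)"
      using finite_links by (intro sum.mono_neutral_cong_right) auto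
    then have "?f * ((\<Sum>e\<in>E. c e) - (\<Sum>e\<in>?cut. c e * useful_share V x S e) * (1 - exp (- t)))
        = ?f * ((\<Sum>e\<in>E. c e) - (\<Sum>e\<in>E. c e * ?p e) * (1 - exp (- t)))"
      by simp
    also have "\<dots> = (\<Sum>e\<in>E. c e * (?f * (1 - ?p e * (1 - exp (- t)))))"
      by (simp only: sum_distrib_right sum_distrib_left sum_subtractf[symmetric]) (simp add: algebra_simps)
    finally show ?thesis by simp
  qed
  finally show ?thesis
    by (simp add: algebra_simps)
qed

lemma weighted_share_bounds:
  assumes x: "valid V x"
  shows "0 \<le> (\<Sum>e\<in>{(u, v)\<in>E. u \<in> S \<and> v \<notin> S}. c e * useful_share V x S e)"
    and "(\<Sum>e\<in>{(u, v)\<in>E. u \<in> S \<and> v \<notin> S}. c e * useful_share V x S e) \<le> (\<Sum>e\<in>E. c e)"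
proof -
  let ?cut = "{(u, v)\<in>E. u \<in> S \<and> v \<notin> S}"
  show "0 \<le> (\<Sum>e\<in>?cut. c e * useful_share V x S e)"
    using useful_share_bounds[OF x] less_imp_le[OF c_pos] by (intro sum_nonneg mult_nonneg_nonneg) auto
  have "(\<Sum>e\<in>?cut. c e * useful_share V x S e) \<le> (\<Sum>e\<in>?cut. c e * 1)"
    using useful_share_bounds[OF x] less_imp_le[OF c_pos] by (intro sum_mono mult_left_mono) auto
  also have "\<dots> \<le> (\<Sum>e\<in>E. c e)"
    using finite_links less_imp_le[OF c_pos] by (simp, intro sum_mono2) auto
  finally show "(\<Sum>e\<in>?cut. c e * useful_share V x S e) \<le> (\<Sum>e\<in>E. c e)" .
qed

text \<open>Finitely many strict inequalities persist for small \<theta> by continuity. Of the three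
  factors \<open>exp \<theta>\<close>, two pay for the exponent \<open>\<theta> * \<beta> S\<close>,
  which is at most 2 \<theta>, and one for shares that are only at least
  \<open>exp (- \<theta>)\<close>.\<close>

lemma capacity_margin:
  assumes "cut_condition V E c lam"
  shows "\<exists>\<theta>>0. \<forall>S. S \<noteq> {} \<and> S \<subset> V \<longrightarrow>
      (\<Sum>u\<in>S. lam u) * exp (3 * \<theta>) < (\<Sum>e\<in>{(u, v)\<in>E. u \<in> S \<and> v \<notin> S}. c e)"
proof -
  let ?SS = "{S. S \<noteq> {} \<and> S \<subset> V}"
  let ?P = "\<lambda>S \<theta>. (\<Sum>u\<in>S. lam u) * exp (3 * \<theta>) < (\<Sum>e\<in>{(u, v)\<in>E. u \<in> S \<and> v \<notin> S}. c e)"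
  have "\<forall>\<^sub>F \<theta> in at_right 0. ?P S \<theta>" if S: "S \<in> ?SS" for S
  proof -
    have "((\<lambda>\<theta>. (\<Sum>u\<in>S. lam u) * exp (3 * \<theta>)) \<longlongrightarrow> (\<Sum>u\<in>S. lam u) * exp (3 * 0)) (at_right (0::real))"
      by (intro tendsto_intros)
    moreover have "(\<Sum>u\<in>S. lam u) * exp (3 * 0) < (\<Sum>e\<in>{(u, v)\<in>E. u \<in> S \<and> v \<notin> S}. c e)"
      using assms S unfolding cut_condition_def by simp
    ultimately show ?thesis
      by (rule order_tendstoD(2))
  qed
  moreover have "finite ?SS"
    by (rule finite_subset[of _ "Pow V"]) (use finV in auto)
  ultimately have "\<forall>\<^sub>F \<theta> in at_right 0. \<forall>S\<in>?SS. ?P S \<theta>"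
    by (intro eventually_ball_finite) auto
  moreover have "\<forall>\<^sub>F \<theta> in at_right (0::real). 0 < \<theta>"
    by (rule eventually_at_right_less)
  ultimately have "\<forall>\<^sub>F \<theta> in at_right (0::real). 0 < \<theta> \<and> (\<forall>S\<in>?SS. ?P S \<theta>)"
    by eventually_elim auto
  then have "\<exists>\<theta>. 0 < \<theta> \<and> (\<forall>S\<in>?SS. ?P S \<theta>)"
    by (rule eventually_happens'[rotated]) simp
  then show ?thesis
    by simp
qed

text \<open>Here the empty configuration is never left, so there is no positive lower bound for exit
  rates as in Foster's criterion; recurrence holds by the convention for absorbing states.\<close>

lemma stable_trivial:
  assumes triv: "\<And>u. u \<in> V \<Longrightarrow> 0 < lam u \<Longrightarrow> V = {u}"
  shows "stable V E c lam random_useful"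
proof -
  let ?q = "network_rate V E c lam random_useful"
  have stay: "y = empty_config" if "0 < ?q empty_config y" for y
    using that
  proof (cases rule: network_rate_pos_cases)
    case (arrive u)
    then show ?thesis using triv arrive_trivial[of V u] by auto
  next
    case (deliver u v r)
    have "useful empty_config (u, v) = {}"
      by (auto simp: useful_def available_def packets_def empty_config_def)
    then show ?thesis
      using deliver by (simp add: set_random_useful[OF valid_empty_config])
  qed
  have "x = empty_config" if "x \<in> reachable ?q empty_config" for x
    using that[unfolded reachable_def mem_Collect_eq] by induction (auto intro: stay)
  moreover have "exit_rate ?q empty_config = 0"
    unfolding exit_rate_def
    by (rule infsum_0) (use stay network_rate_nonneg[of random_useful empty_config] in \<open>force simp: less_le\<close>)
  ultimately show ?thesis
    unfolding stable_def positive_recurrent_def by blast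
qed

lemma stable_random_useful:
  assumes cut: "cut_condition V E c lam"
  shows "stable V E c lam random_useful"
proof (cases "\<forall>u\<in>V. 0 < lam u \<longrightarrow> V = {u}")
  case True
  then show ?thesis using stable_trivial by blast
next
  case False
  then obtain u\<^sub>0 where u0: "u\<^sub>0 \<in> V" "0 < lam u\<^sub>0" "V \<noteq> {u\<^sub>0}" by auto
  then obtain w\<^sub>0 where w0: "w\<^sub>0 \<in> V" "w\<^sub>0 \<noteq> u\<^sub>0" by auto
  let ?q = "network_rate V E c lam random_useful"
  define X where "X = reachable ?q empty_config"
  define SS where "SS = {S. S \<noteq> {} \<and> S \<subset> V}"
  define R where "R = (\<Sum>u\<in>V. lam u) + (\<Sum>e\<in>E. c e)"
  define lamS where "lamS S = (\<Sum>u\<in>S. lam u)" for S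
  define cS where "cS S = (\<Sum>e\<in>{(u, v)\<in>E. u \<in> S \<and> v \<notin> S}. c e)" for S
  have valid: "valid V x" if "x \<in> X" for x
    using valid_reachable[OF admissible_random_useful] that unfolding X_def by blast
  have finSS: "finite SS"
    unfolding SS_def by (rule finite_subset[of _ "Pow V"]) (use finV in auto)
  have co_singleton: "V - {v} \<in> SS" if "v \<in> V" for v
    using u0 w0 that by (auto simp: SS_def)
  have lamS: "0 \<le> lamS S" "lamS S \<le> lamS V" if "S \<in> SS" for S
    using that finV lam_nonneg unfolding SS_def lamS_def by (auto intro!: sum_nonneg sum_mono2)
  obtain \<theta> where theta: "0 < \<theta>"
    and "\<forall>S. S \<noteq> {} \<and> S \<subset> V \<longrightarrow>
      (\<Sum>u\<in>S. lam u) * exp (3 * \<theta>) < (\<Sum>e\<in>{(u, v)\<in>E. u \<in> S \<and> v \<notin> S}. c e)"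
    using capacity_margin[OF cut] by auto
  then have margin: "lamS S * exp (3 * \<theta>) < cS S" if "S \<in> SS" for S
    using that by (simp add: SS_def lamS_def cS_def)
  \<comment> \<open>With this choice a share of at least \<open>1 - \<rho>\<close> is one of at
    least \<open>exp (- \<theta>)\<close>, as budgeted in the margin.\<close>
  define \<rho> where "\<rho> = 1 - exp (- \<theta>)"
  have rho: "0 < \<rho>" "\<rho> \<le> 1"
    using theta by (auto simp: \<rho>_def)
  define \<beta> where "\<beta> S = 1 + (\<rho> / 6) ^ card S" for S :: "'v set"
  \<comment> \<open>The largest value that \<open>larger_weighted_occupancy\<close> admits.\<close>
  define \<kappa> where "\<kappa> = (\<rho> / 6) ^ card V / 2"
  have kappa: "0 < \<kappa>"
    using rho by (simp add: \<kappa>_def)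
  have beta: "1 \<le> \<beta> S" "\<beta> S \<le> 2" for S
    using rho power_le_one[of "\<rho> / 6" "card S"] by (auto simp: \<beta>_def)
  define W where "W S x = \<beta> S * card (confined V x S)" for S x
  define f where "f S x = exp (\<theta> * W S x)" for S x
  define L where "L x = (\<Sum>S\<in>SS. f S x)" for x
  define g where "g S x = f S x * (R + lamS S * (exp (\<theta> * \<beta> S) - 1)
    - (\<Sum>e\<in>{(u, v)\<in>E. u \<in> S \<and> v \<notin> S}. c e * useful_share V x S e) * (1 - exp (- (\<theta> * \<beta> S))))" for S x
  \<comment> \<open>Bounds the relative growth of \<open>f S\<close> for every \<open>S\<close>,
    whatever its shares are.\<close>
  define K where "K = lamS V * exp (2 * \<theta>)"
  \<comment> \<open>The guaranteed relative decrease of \<open>f S\<close> when all shares of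
    \<open>S\<close> are large; \<rho> stands for the lower bound of
    \<open>1 - exp (- (\<theta> * \<beta> S))\<close>.\<close>
  define \<epsilon> where "\<epsilon> = Min ((\<lambda>S. \<rho> * exp (- \<theta>) * (cS S - lamS S * exp (3 * \<theta>))) ` SS)"
  have SS_ne: "SS \<noteq> {}"
    using co_singleton[OF u0(1)] by auto
  have eps: "0 < \<epsilon>"
    unfolding \<epsilon>_def using finSS SS_ne margin rho by (subst Min_gr_iff) auto
  have eps_le: "\<epsilon> \<le> \<rho> * exp (- \<theta>) * (cS S - lamS S * exp (3 * \<theta>))" if "S \<in> SS" for S
    unfolding \<epsilon>_def using finSS that by (intro Min_le) auto
  have "0 \<le> lamS V"
    unfolding lamS_def using lam_nonneg by (intro sum_nonneg) auto
  then have K: "0 \<le> K"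
    by (simp add: K_def)
  have f_pos: "0 < f S x" for S x
    by (simp add: f_def)
  have tb: "\<theta> \<le> \<theta> * \<beta> S" "\<theta> * \<beta> S \<le> 2 * \<theta>" for S
    using beta[of S] theta by auto
  have rs: "rate_sum ?q (\<lambda>y. ennreal (f S y)) x = ennreal (g S x)" if "S \<in> SS" "x \<in> X" for S x
    using rate_sum_exp[OF valid[OF that(2)], of S "\<theta> * \<beta> S"] theta tb(1)[of S] that(1)
    unfolding f_def g_def W_def R_def lamS_def SS_def by (simp add: mult.assoc)
  have g_nonneg: "0 \<le> g S x" if "S \<in> SS" "x \<in> X" for S x
  proof -
    have "(\<Sum>e\<in>{(u, v)\<in>E. u \<in> S \<and> v \<notin> S}. c e * useful_share V x S e) * (1 - exp (- (\<theta> * \<beta> S))) \<le> (\<Sum>e\<in>E. c e) * 1"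
      using weighted_share_bounds[OF valid[OF that(2)], of S] theta tb(1)[of S] less_imp_le[OF c_pos]
      by (intro mult_mono) (auto intro: sum_nonneg)
    moreover have "0 \<le> (\<Sum>u\<in>V. lam u)"
      using lam_nonneg by (rule sum_nonneg)
    moreover have "0 \<le> lamS S * (exp (\<theta> * \<beta> S) - 1)"
      using lamS[OF that(1)] theta tb(1)[of S] by (intro mult_nonneg_nonneg) auto
    ultimately show ?thesis
      unfolding g_def R_def using f_pos[of S x] by (intro mult_nonneg_nonneg) auto
  qed
  have rs_L: "rate_sum ?q (\<lambda>y. ennreal (L y)) x = ennreal (\<Sum>S\<in>SS. g S x)" if "x \<in> X" for x
  proof -
    have L_eq: "ennreal (L y) = (\<Sum>S\<in>SS. ennreal (f S y))" for y
      unfolding L_def by (rule sum_ennreal[symmetric]) (rule less_imp_le[OF f_pos])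
    have "rate_sum ?q (\<lambda>y. ennreal (L y)) x = (\<Sum>S\<in>SS. rate_sum ?q (\<lambda>y. ennreal (f S y)) x)"
      unfolding rate_sum_def L_eq sum_distrib_left by (rule nn_integral_sum) simp
    also have "\<dots> = (\<Sum>S\<in>SS. ennreal (g S x))"
      using rs that by (intro sum.cong) auto
    also have "\<dots> = ennreal (\<Sum>S\<in>SS. g S x)"
      using g_nonneg that by (intro sum_ennreal) auto
    finally show ?thesis .
  qed
  have g_le: "g S x \<le> (R + K) * f S x" if "S \<in> SS" "x \<in> X" for S x
  proof -
    have "lamS S * (exp (\<theta> * \<beta> S) - 1) \<le> lamS V * exp (2 * \<theta>)"
    proof (rule mult_mono)
      have "exp (\<theta> * \<beta> S) \<le> exp (2 * \<theta>)" using tb(2) by simp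
      then show "exp (\<theta> * \<beta> S) - 1 \<le> exp (2 * \<theta>)" by linarith
    qed (use lamS[OF that(1)] theta tb(1)[of S] \<open>0 \<le> lamS V\<close> in auto)
    moreover have "0 \<le> (\<Sum>e\<in>{(u, v)\<in>E. u \<in> S \<and> v \<notin> S}. c e * useful_share V x S e) * (1 - exp (- (\<theta> * \<beta> S)))"
      using weighted_share_bounds[OF valid[OF that(2)], of S] theta tb(1)[of S]
      by (intro mult_nonneg_nonneg) auto
    ultimately have "R + lamS S * (exp (\<theta> * \<beta> S) - 1)
      - (\<Sum>e\<in>{(u, v)\<in>E. u \<in> S \<and> v \<notin> S}. c e * useful_share V x S e) * (1 - exp (- (\<theta> * \<beta> S))) \<le> R + K"
      unfolding K_def by linarith
    then show ?thesis
      unfolding g_def mult.commute[of "f S x"] by (rule mult_right_mono) (rule less_imp_le[OF f_pos])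
  qed
  have g_good: "g S x \<le> (R - \<epsilon>) * f S x"
    if S: "S \<in> SS" and x: "x \<in> X"
      and good: "\<And>u v. (u, v) \<in> E \<Longrightarrow> u \<in> S \<Longrightarrow> v \<notin> S \<Longrightarrow> 1 - \<rho> \<le> useful_share V x S (u, v)" for S x
  proof -
    let ?D = "\<Sum>e\<in>{(u, v)\<in>E. u \<in> S \<and> v \<notin> S}. c e * useful_share V x S e"
    let ?r = "1 - exp (- (\<theta> * \<beta> S))"
    have r: "\<rho> \<le> ?r"
      using tb(1)[of S] by (simp add: \<rho>_def)
    with rho have r0: "0 \<le> ?r" by linarith
    have D: "exp (- \<theta>) * cS S \<le> ?D"
      unfolding cS_def sum_distrib_left using good c_pos
      by (intro sum_mono) (auto simp: \<rho>_def mult.commute[of "exp _"] intro!: mult_left_mono less_imp_le[OF c_pos])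
    have "exp (\<theta> * \<beta> S) - 1 = exp (\<theta> * \<beta> S) * ?r"
      by (simp add: right_diff_distrib exp_add[symmetric])
    then have "lamS S * (exp (\<theta> * \<beta> S) - 1) = (lamS S * exp (\<theta> * \<beta> S)) * ?r"
      by simp
    also have "\<dots> \<le> (lamS S * exp (2 * \<theta>)) * ?r"
      by (intro mult_right_mono mult_left_mono r0 lamS[OF S]) (use tb(2)[of S] in simp)
    finally have "lamS S * (exp (\<theta> * \<beta> S) - 1) - ?D * ?r \<le> (lamS S * exp (2 * \<theta>)) * ?r - (exp (- \<theta>) * cS S) * ?r"
      using mult_right_mono[OF D r0] by linarith
    also have "\<dots> = - (?r * (exp (- \<theta>) * (cS S - lamS S * exp (3 * \<theta>))))"
    proof -
      have "exp (2 * \<theta>) = exp (- \<theta>) * exp (3 * \<theta>)"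
        by (simp add: exp_add[symmetric])
      then show ?thesis
        by (simp add: algebra_simps)
    qed
    also have "\<dots> \<le> - (\<rho> * (exp (- \<theta>) * (cS S - lamS S * exp (3 * \<theta>))))"
      using r margin[OF S] by (intro le_imp_neg_le mult_right_mono mult_nonneg_nonneg) auto
    also have "\<dots> \<le> - \<epsilon>"
      using eps_le[OF S] by (simp add: mult.assoc)
    finally have "R + lamS S * (exp (\<theta> * \<beta> S) - 1) - ?D * ?r \<le> R - \<epsilon>"
      by simp
    then show ?thesis
      unfolding g_def mult.commute[of "f S x"] by (rule mult_right_mono) (rule less_imp_le[OF f_pos])
  qed
  \<comment> \<open>\<open>h * m\<close> is the gap between the exponent \<open>\<theta> * m\<close>
    of a maximal set and that of a set smaller by the factor \<open>1 + \<kappa>\<close>. The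
    threshold \<open>m\<^sub>0\<close> is such that the gap outweighs all bad sets with 1 to spare:
    \<open>(C + 1) / \<epsilon> = h * m\<^sub>0\<close>, which is at most
    \<open>exp (h * m)\<close>.\<close>
  define h where "h = \<theta> * (1 - 1 / (1 + \<kappa>))"
  have h: "0 < h"
    unfolding h_def using theta kappa by simp
  define C where "C = card SS * K"
  have C: "0 \<le> C" using K by (simp add: C_def)
  define m\<^sub>0 where "m\<^sub>0 = (C + 1) / (\<epsilon> * h)"
  have m0: "0 < m\<^sub>0"
    unfolding m\<^sub>0_def using C eps h by simp
  define F where "F = {x \<in> X. \<forall>S\<in>SS. W S x < m\<^sub>0}"
  have F: "finite F"
  proof (rule finite_subset[OF _ finite_valid_configs[OF finV]])
    show "F \<subseteq> {x. valid V x \<and> card (packets x) \<le> card V * nat \<lceil>m\<^sub>0\<rceil>}"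
    proof
      fix x assume x: "x \<in> F"
      then have vx: "valid V x" using valid by (auto simp: F_def)
      have "card (confined V x (V - {v})) \<le> nat \<lceil>m\<^sub>0\<rceil>" if "v \<in> V" for v
      proof -
        have "1 * real (card (confined V x (V - {v}))) \<le> W (V - {v}) x"
          unfolding W_def using beta by (intro mult_right_mono) auto
        also have "\<dots> < m\<^sub>0"
          using x co_singleton[OF that] by (auto simp: F_def)
        finally show ?thesis by linarith
      qed
      then have "(\<Sum>v\<in>V. card (confined V x (V - {v}))) \<le> card V * nat \<lceil>m\<^sub>0\<rceil>"
        using sum_bounded_above[of V "\<lambda>v. card (confined V x (V - {v}))"] by simp
      then show "x \<in> {x. valid V x \<and> card (packets x) \<le> card V * nat \<lceil>m\<^sub>0\<rceil>}"
        using card_packets_le[OF finV vx] vx by simp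
    qed
  qed
  have drift: "(\<Sum>S\<in>SS. g S x) + 1 \<le> R * L x" if xF: "x \<in> X - F" for x
  proof -
    have x: "x \<in> X" using xF by simp
    define m where "m = Max ((\<lambda>S. W S x) ` SS)"
    have m_ge: "W S x \<le> m" if "S \<in> SS" for S
      unfolding m_def using finSS that by (intro Max_ge) auto
    obtain T where T: "T \<in> SS" "W T x = m"
      using Max_in[of "(\<lambda>S. W S x) ` SS"] finSS SS_ne unfolding m_def[symmetric] by auto
    have "m\<^sub>0 \<le> m"
      using xF m_ge by (auto simp: F_def not_less intro: order_trans)
    with m0 have m: "0 < m" by simp
    have bad: "(1 + \<kappa>) * W S x \<le> m"
      if S: "S \<in> SS" and uv: "(u, v) \<in> E" "u \<in> S" "v \<notin> S" "useful_share V x S (u, v) < 1 - \<rho>" for S u v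
    proof -
      have "\<exists>T. T \<noteq> {} \<and> T \<subset> V \<and> (1 + \<kappa>) * (\<beta> S * card (confined V x S)) \<le> \<beta> T * card (confined V x T)"
        unfolding \<beta>_def
        by (rule larger_weighted_occupancy[OF finV valid[OF x] rho _ _ _ uv(2) _ uv(3,4)])
          (use S uv(1) E kappa in \<open>auto simp: SS_def \<kappa>_def\<close>)
      then show ?thesis
        using m_ge unfolding W_def SS_def by (blast intro: order_trans)
    qed
    have fm: "f T x = exp (\<theta> * m)"
      by (simp add: f_def T)
    let ?b = "exp (\<theta> * (m / (1 + \<kappa>)))"
    have g_bound: "g S x \<le> R * f S x + K * ?b - (if S = T then \<epsilon> * exp (\<theta> * m) else 0)" if S: "S \<in> SS" for S
    proof (cases "\<exists>u v. (u, v) \<in> E \<and> u \<in> S \<and> v \<notin> S \<and> useful_share V x S (u, v) < 1 - \<rho>")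
      case True
      then have le: "(1 + \<kappa>) * W S x \<le> m"
        using bad[OF S] by blast
      \<comment> \<open>No set exceeds the maximum, which is positive outside \<open>F\<close>; so
        all shares of \<open>T\<close> are large, and its decrease is available to pay for the bad
        sets.\<close>
      have "S \<noteq> T"
      proof
        assume "S = T"
        with le T have "(1 + \<kappa>) * m \<le> m" by simp
        then have "\<kappa> * m \<le> 0" by (simp add: algebra_simps)
        with m kappa show False by (simp add: mult_le_0_iff)
      qed
      have "W S x \<le> m / (1 + \<kappa>)"
        using le kappa by (simp add: le_divide_eq mult.commute)
      then have "f S x \<le> ?b"
        unfolding f_def exp_le_cancel_iff using theta by (intro mult_left_mono) auto
      then have "K * f S x \<le> K * ?b"
        using K by (rule mult_left_mono)
      then show ?thesis
        using g_le[OF S x] \<open>S \<noteq> T\<close> by (simp add: distrib_right)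
    next
      case False
      then have "g S x \<le> (R - \<epsilon>) * f S x"
        by (intro g_good[OF S x]) (auto simp: not_less)
      moreover have "0 \<le> K * ?b" "0 \<le> \<epsilon> * f S x"
        using K eps f_pos[of S x] by auto
      ultimately show ?thesis
        using fm by (auto simp: left_diff_distrib)
    qed
    have "(\<Sum>S\<in>SS. g S x) \<le> (\<Sum>S\<in>SS. R * f S x + K * ?b - (if S = T then \<epsilon> * exp (\<theta> * m) else 0))"
      by (intro sum_mono g_bound)
    also have "\<dots> = R * L x + C * ?b - \<epsilon> * exp (\<theta> * m)"
      using finSS T(1) by (simp add: sum_subtractf sum.distrib L_def sum_distrib_left C_def)
    also have "\<dots> \<le> R * L x - 1"
    proof -
      have "(C + 1) / \<epsilon> = h * m\<^sub>0"
        unfolding m\<^sub>0_def using h eps by simp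
      also have "\<dots> \<le> h * m"
        using h \<open>m\<^sub>0 \<le> m\<close> by simp
      also have "\<dots> \<le> exp (h * m)"
        using exp_ge_add_one_self[of "h * m"] by linarith
      finally have "C + 1 \<le> \<epsilon> * exp (h * m)"
        using eps by (simp add: divide_le_eq mult.commute)
      then have "(C + 1) * ?b \<le> \<epsilon> * exp (h * m) * ?b"
        by (rule mult_right_mono) simp
      also have "\<dots> = \<epsilon> * exp (\<theta> * m)"
      proof -
        have "h * m + \<theta> * (m / (1 + \<kappa>)) = \<theta> * m"
          by (simp add: h_def algebra_simps)
        then show ?thesis
          by (simp add: mult.assoc exp_add[symmetric])
      qed
      finally have "C * ?b + ?b \<le> \<epsilon> * exp (\<theta> * m)"
        by (simp add: distrib_right)
      moreover have "1 \<le> ?b"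
        using theta m kappa by simp
      ultimately show ?thesis by linarith
    qed
    finally show ?thesis by simp
  qed
  have "positive_recurrent ?q x" if x: "x \<in> X" for x
  proof (rule positive_recurrent_of_drift[where X=X and F=F and L=L and R=R and r="lam u\<^sub>0" and \<epsilon>=1])
    show "0 \<le> ?q z y" for z y
      by (rule network_rate_nonneg)
    show "y \<in> X" if "z \<in> X" "0 < ?q z y" for z y
      using that unfolding X_def by (rule reachable_step[where q="?q"])
    show "rate_sum ?q (\<lambda>_. 1) z = ennreal R" for z
      unfolding R_def by (rule rate_sum_network_1)
    show "0 < lam u\<^sub>0" by (rule u0)
    show "lam u\<^sub>0 \<le> exit_rate ?q z" if z: "z \<in> X" for z
    proof -
      \<comment> \<open>The new packet is missing at \<open>w\<^sub>0\<close> and has a fresh label,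
        so an arrival at \<open>u\<^sub>0\<close> changes every configuration. This bounds all exit
        rates from below.\<close>
      have "arrive V z u\<^sub>0 \<noteq> z"
        using packets_arrive[OF w0, of z] new_label(1)[OF valid[OF z]] by auto
      then have "?q z (arrive V z u\<^sub>0) \<le> exit_rate ?q z"
        by (intro le_exit_rate network_rate_nonneg) (simp_all add: rate_sum_network_1)
      then show ?thesis
        using network_rate_arrive[OF u0(1), of random_useful z] by simp
    qed
    \<comment> \<open>The way leads through the empty configuration, from which \<open>x\<close> is
      reachable.\<close>
    show "(\<lambda>a b. 0 < ?q a b)\<^sup>*\<^sup>* z x" if "z \<in> X" for z
      using reaches_empty_config[OF cut valid[OF that]] x unfolding X_def reachable_def by simp
    show "x \<in> X" by (rule x)
    show "finite F" by (rule F)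
    show "F \<subseteq> X" by (auto simp: F_def)
    show "rate_sum ?q (\<lambda>y. ennreal (L y)) z + ennreal 1 \<le> ennreal R * ennreal (L z)" if zF: "z \<in> X - F" for z
    proof -
      have z: "z \<in> X" using zF by simp
      have "rate_sum ?q (\<lambda>y. ennreal (L y)) z + ennreal 1 = ennreal ((\<Sum>S\<in>SS. g S z) + 1)"
        unfolding rs_L[OF z] by (rule ennreal_plus[symmetric]) (use g_nonneg z in \<open>auto intro: sum_nonneg\<close>)
      also have "\<dots> \<le> ennreal (R * L z)"
        using drift[OF zF] by (rule ennreal_leI)
      also have "\<dots> = ennreal R * ennreal (L z)"
        by (rule ennreal_mult'') (auto simp: L_def intro!: sum_nonneg less_imp_le[OF f_pos])
      finally show ?thesis .
    qed
    show "rate_sum ?q (\<lambda>y. ennreal (L y)) z < \<infinity>" if "z \<in> F" for z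
      using rs_L[of z] that by (simp add: F_def)
  qed simp
  then show ?thesis
    unfolding stable_def X_def by blast
qed

text \<open>If \<open>lam\<close> vanishes on \<open>S\<close>, the inequality only says that some
  link leaves \<open>S\<close>. Otherwise packets do arrive in \<open>S\<close>, and a violated
  inequality contradicts stability by \<open>not_stable\<close>.\<close>

lemma cut_condition_of_stable:
  assumes nondegenerate: "\<And>S. S \<noteq> {} \<Longrightarrow> S \<subset> V \<Longrightarrow> (\<forall>u\<in>S. lam u = 0)
           \<Longrightarrow> \<exists>(u, v)\<in>E. u \<in> S \<and> v \<notin> S"
    and d: "admissible_on_valid V E d" and stable: "stable V E c lam d"
  shows "cut_condition V E c lam"
  unfolding cut_condition_def
proof (intro allI impI, rule ccontr)
  fix S assume S: "S \<noteq> {} \<and> S \<subset> V"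
    and "\<not> (\<Sum>u\<in>S. lam u) < (\<Sum>e\<in>{(u, v)\<in>E. u \<in> S \<and> v \<notin> S}. c e)"
  then have le: "(\<Sum>e\<in>{(u, v)\<in>E. u \<in> S \<and> v \<notin> S}. c e) \<le> (\<Sum>u\<in>S. lam u)" by simp
  show False
  proof (cases "\<forall>u\<in>S. lam u = 0")
    case True
    then obtain u v where "(u, v) \<in> E" "u \<in> S" "v \<notin> S"
      using nondegenerate S by blast
    then have "{(u, v)\<in>E. u \<in> S \<and> v \<notin> S} \<noteq> {}" by auto
    then have "0 < (\<Sum>e\<in>{(u, v)\<in>E. u \<in> S \<and> v \<notin> S}. c e)"
      using finite_links c_pos by (intro sum_pos) (auto intro: finite_subset)
    with le True show False by simp
  next
    case False
    then obtain u where "u \<in> S" "lam u \<noteq> 0" by auto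
    moreover from this have "0 < lam u"
      using lam_nonneg[of u] S by auto
    ultimately show False
      using not_stable[OF d _ _ _ le, of u] S stable by auto
  qed
qed

end

theorem theorem3p2:
  fixes V :: "'v set" and E :: "('v \<times> 'v) set"
    and c :: "'v \<times> 'v \<Rightarrow> real" and lam :: "'v \<Rightarrow> real"
  assumes "finite V" and "E \<subseteq> V \<times> V"
    and "\<And>e. e \<in> E \<Longrightarrow> 0 < c e"
    and "\<And>u. u \<in> V \<Longrightarrow> 0 \<le> lam u"
    and nondegenerate: "\<And>S. S \<noteq> {} \<Longrightarrow> S \<subset> V \<Longrightarrow> (\<forall>u\<in>S. lam u = 0)
           \<Longrightarrow> \<exists>(u, v)\<in>E. u \<in> S \<and> v \<notin> S"
  shows "(stable V E c lam random_useful \<longleftrightarrow> cut_condition V E c lam) \<and>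
         (\<forall>d. admissible E d \<and> stable V E c lam d \<longrightarrow> cut_condition V E c lam)"
proof -
  interpret broadcast_network V E c lam
    using assms(1-4) by unfold_locales
  have "admissible_on_valid V E d" if "admissible E d" for d
    using that unfolding admissible_def admissible_on_valid_def by blast
  then show ?thesis
    using stable_random_useful cut_condition_of_stable[OF nondegenerate] admissible_random_useful by blast
qed

end
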